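(* Consider the following setting. There are $m$ independent $\{0,1\}$-valued variables; for $\vec z\in[0,1]^m$, $\mu_{\vec z}$ is the product distribution on $\{0,1\}^m$ with expectation $\vec z$. Events $\mathcal{E}_1,\dots,\mathcal{E}_n\subseteq\{0,1\}^m$ are given, where $\mathcal{E}_i$ depends only on the coordinates in a set $A_i\subseteq[m]$. Let $G$ be the graph on $[n]$ in which distinct $i,j$ are adjacent iff $A_i\cap A_j\neq\emptyset$, and let $d$ be the maximum degree of $G$. For $\vec z\in[0,1]^m$ let $\vec p(\vec z)\in[0,1]^n$ be given by $p_i(\vec z)=\mu_{\vec z}(\mathcal{E}_i)$. Suppose the initial vector $\vec z\in[0,1]^m$ and $\alpha\in(0,1]$ satisfy $(1+\alpha)\cdot\vec p(\vec z)\in\mathcal{S}_G$, and that $\vec p(\vec z')$ can be computed from any $\vec z'\in[0,1]^m$ in time polynomial in $m$. Then there is a deterministic algorithm with running time $(nm/\alpha)^{O(\log(d)\sqrt{m/\alpha})}$ that constructs a point $\omega\in\{0,1\}^m$ with $\omega\in\bigcap_{i=1}^n\overline{\mathcal{E}_i}$.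
   Context: For a graph $G=(V,E)$, the Shearer region is $\mathcal{S}_G=\{\vec p\in[0,1]^V : Z_G(\vec w)\neq 0 \text{ for all } \vec w\in\mathbb{C}^V \text{ with } |w_v|\le p_v\ \forall v\}$, where $Z_G(\vec w)=\sum_I\prod_{v\in I}w_v$ over independent sets $I$ of $G$. Equivalently, for real $\vec p$, $\vec p\in\mathcal{S}_G$ iff $\breve q_S(\vec p)=\sum_{I\subseteq S\text{ independent}}(-1)^{|I|}\prod_{v\in I}p_v>0$ for every $S\subseteq V$. $\overline{\mathcal{E}_i}$ is the complement of $\mathcal{E}_i$.
   Formalization: In the running time, log(d) is read as log(max(2,d)) and a constant leading factor is allowed, since for d ≤ 1 (or nm/α = 1) the printed bound is undefined or a single step; time is counted in unit-cost exact real arithmetic. *)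

theory Defs
  imports "HOL-Probability.Probability" "HOL-Computational_Algebra.Polynomial"
begin

section \<open>Independence polynomial and Shearer region\<close>

text \<open>A finite simple graph is given by its vertex set \<open>V\<close> and its adjacency relation \<open>adj\<close>.\<close>

definition independent_in :: "'a set \<Rightarrow> ('a \<Rightarrow> 'a \<Rightarrow> bool) \<Rightarrow> 'a set \<Rightarrow> bool" where
  "independent_in V adj I \<longleftrightarrow> I \<subseteq> V \<and> (\<forall>u\<in>I. \<forall>v\<in>I. \<not> adj u v)"

definition indep_poly :: "'a set \<Rightarrow> ('a \<Rightarrow> 'a \<Rightarrow> bool) \<Rightarrow> ('a \<Rightarrow> complex) \<Rightarrow> complex" where
  "indep_poly V adj w = (\<Sum>I | independent_in V adj I. \<Prod>v\<in>I. w v)"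

text \<open>Vectors indexed by \<open>V\<close> are total functions; their values outside \<open>V\<close> are irrelevant.\<close>

definition shearer_region :: "'a set \<Rightarrow> ('a \<Rightarrow> 'a \<Rightarrow> bool) \<Rightarrow> ('a \<Rightarrow> real) set" where
  "shearer_region V adj =
     {p. (\<forall>v\<in>V. 0 \<le> p v \<and> p v \<le> 1) \<and>
         (\<forall>w :: 'a \<Rightarrow> complex. (\<forall>v\<in>V. cmod (w v) \<le> p v) \<longrightarrow> indep_poly V adj w \<noteq> 0)}"

definition max_degree :: "'a set \<Rightarrow> ('a \<Rightarrow> 'a \<Rightarrow> bool) \<Rightarrow> nat" where
  "max_degree V adj = Max ((\<lambda>v. card {u \<in> V. adj v u}) ` V)"

section \<open>Events on the cube\<close>

text \<open>
  Coordinates are \<open>0, \<dots>, m - 1\<close> and events are \<open>0, \<dots>, n - 1\<close>. A point of \<open>{0,1}\<close> to the power \<open>m\<close>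
  is a function \<open>nat \<Rightarrow> bool\<close> (\<open>True\<close> for 1) that is \<open>False\<close> outside \<open>{..<m}\<close>, which is the support
  convention of \<open>Pi_pmf {..<m} False\<close>.
\<close>

definition cube :: "nat \<Rightarrow> (nat \<Rightarrow> bool) set" where
  "cube m = {\<omega>. \<forall>j. \<omega> j \<longrightarrow> j < m}"

definition unit_vector :: "nat \<Rightarrow> (nat \<Rightarrow> real) \<Rightarrow> bool" where
  "unit_vector m z \<longleftrightarrow> (\<forall>j<m. 0 \<le> z j \<and> z j \<le> 1)"

definition prod_dist :: "nat \<Rightarrow> (nat \<Rightarrow> real) \<Rightarrow> (nat \<Rightarrow> bool) pmf" where
  "prod_dist m z = Pi_pmf {..<m} False (\<lambda>j. bernoulli_pmf (z j))"

definition event_prob :: "nat \<Rightarrow> (nat \<Rightarrow> (nat \<Rightarrow> bool) set) \<Rightarrow> (nat \<Rightarrow> real) \<Rightarrow> nat \<Rightarrow> real" where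
  "event_prob m E z i = measure_pmf.prob (prod_dist m z) (E i)"

definition depends_only_on :: "nat \<Rightarrow> (nat \<Rightarrow> bool) set \<Rightarrow> nat set \<Rightarrow> bool" where
  "depends_only_on m F A \<longleftrightarrow>
     (\<forall>\<omega>\<in>cube m. \<forall>\<omega>'\<in>cube m. (\<forall>j\<in>A. \<omega> j = \<omega>' j) \<longrightarrow> (\<omega> \<in> F \<longleftrightarrow> \<omega>' \<in> F))"

definition event_system ::
    "nat \<Rightarrow> nat \<Rightarrow> (nat \<Rightarrow> nat set) \<Rightarrow> (nat \<Rightarrow> (nat \<Rightarrow> bool) set) \<Rightarrow> bool" where
  "event_system m n A E \<longleftrightarrow>
     (\<forall>i<n. A i \<subseteq> {..<m} \<and> E i \<subseteq> cube m \<and> depends_only_on m (E i) (A i))"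

definition dep_adj :: "(nat \<Rightarrow> nat set) \<Rightarrow> nat \<Rightarrow> nat \<Rightarrow> bool" where
  "dep_adj A i j \<longleftrightarrow> i \<noteq> j \<and> A i \<inter> A j \<noteq> {}"

section \<open>Deterministic algorithms over the reals\<close>

text \<open>
  Vectors \<open>z\<close> range over real points, so running time is counted in the unit-cost exact real
  model: arithmetic and comparison of reals take one step each, and there is no rounding, no
  transcendental function and no real constant other than natural number literals. Algorithms
  are programs of a first-order call-by-value language with general recursion on trees with real
  leaves. Every evaluated expression node costs one step; as values are immutable (hence shareable
  by reference) and every node acts on constantly many references, each step is a constant number of
  operations of a real random access machine. A program is a finite text that does not depend on its
  input.
\<close>

datatype val = VNum real | VNil | VCons val val

datatype arith_op = Add | Sub | Mul | Div

fun arith :: "arith_op \<Rightarrow> real \<Rightarrow> real \<Rightarrow> real" where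
  "arith Add x y = x + y"
| "arith Sub x y = x - y"
| "arith Mul x y = x * y"
| "arith Div x y = x / y"

text \<open>
  Variables are de Bruijn indices into the environment. \<open>Let\<close> binds one variable, the third argument
  of \<open>CaseList\<close> is evaluated with head (index 0) and tail (index 1) bound, and a function body
  sees exactly its argument.
\<close>

datatype exp =
    Var nat
  | Let exp exp
  | Lit nat
  | Arith arith_op exp exp
  | IfLess exp exp exp exp
  | NilE
  | ConsE exp exp
  | CaseList exp exp exp
  | Call nat exp

text \<open>\<open>eval Fs \<rho> e t v\<close>: with function bodies \<open>Fs\<close>, in environment \<open>\<rho>\<close>, \<open>e\<close> evaluates to \<open>v\<close> in
  exactly \<open>t\<close> steps. Evaluation that diverges or gets stuck has no derivation.\<close>

inductive eval :: "exp list \<Rightarrow> val list \<Rightarrow> exp \<Rightarrow> nat \<Rightarrow> val \<Rightarrow> bool" for Fs where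
  Var: "k < length \<rho> \<Longrightarrow> eval Fs \<rho> (Var k) 1 (\<rho> ! k)"
| Let: "eval Fs \<rho> e1 t1 v1 \<Longrightarrow> eval Fs (v1 # \<rho>) e2 t2 v2 \<Longrightarrow>
    eval Fs \<rho> (Let e1 e2) (1 + t1 + t2) v2"
| Lit: "eval Fs \<rho> (Lit k) 1 (VNum (real k))"
| Arith: "eval Fs \<rho> e1 t1 (VNum x) \<Longrightarrow> eval Fs \<rho> e2 t2 (VNum y) \<Longrightarrow>
    eval Fs \<rho> (Arith f e1 e2) (1 + t1 + t2) (VNum (arith f x y))"
| IfLess_True: "eval Fs \<rho> e1 t1 (VNum x) \<Longrightarrow> eval Fs \<rho> e2 t2 (VNum y) \<Longrightarrow> x < y \<Longrightarrow>
    eval Fs \<rho> e3 t3 v \<Longrightarrow> eval Fs \<rho> (IfLess e1 e2 e3 e4) (1 + t1 + t2 + t3) v"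
| IfLess_False: "eval Fs \<rho> e1 t1 (VNum x) \<Longrightarrow> eval Fs \<rho> e2 t2 (VNum y) \<Longrightarrow> \<not> x < y \<Longrightarrow>
    eval Fs \<rho> e4 t4 v \<Longrightarrow> eval Fs \<rho> (IfLess e1 e2 e3 e4) (1 + t1 + t2 + t4) v"
| NilE: "eval Fs \<rho> NilE 1 VNil"
| ConsE: "eval Fs \<rho> e1 t1 v1 \<Longrightarrow> eval Fs \<rho> e2 t2 v2 \<Longrightarrow>
    eval Fs \<rho> (ConsE e1 e2) (1 + t1 + t2) (VCons v1 v2)"
| CaseList_Nil: "eval Fs \<rho> e1 t1 VNil \<Longrightarrow> eval Fs \<rho> e2 t2 v \<Longrightarrow>
    eval Fs \<rho> (CaseList e1 e2 e3) (1 + t1 + t2) v"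
| CaseList_Cons: "eval Fs \<rho> e1 t1 (VCons h r) \<Longrightarrow> eval Fs (h # r # \<rho>) e3 t3 v \<Longrightarrow>
    eval Fs \<rho> (CaseList e1 e2 e3) (1 + t1 + t3) v"
| Call: "k < length Fs \<Longrightarrow> eval Fs \<rho> e t1 a \<Longrightarrow> eval Fs [a] (Fs ! k) t2 v \<Longrightarrow>
    eval Fs \<rho> (Call k e) (1 + t1 + t2) v"

inductive_cases eval_cases:
  "eval Fs \<rho> (Var k) t v" "eval Fs \<rho> (Let e1 e2) t v" "eval Fs \<rho> (Lit k) t v"
  "eval Fs \<rho> (Arith f e1 e2) t v" "eval Fs \<rho> (IfLess e1 e2 e3 e4) t v" "eval Fs \<rho> NilE t v"
  "eval Fs \<rho> (ConsE e1 e2) t v" "eval Fs \<rho> (CaseList e1 e2 e3) t v" "eval Fs \<rho> (Call k e) t v"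

lemma eval_deterministic:
  "eval Fs \<rho> e t v \<Longrightarrow> eval Fs \<rho> e t' v' \<Longrightarrow> t' = t \<and> v' = v"
proof (induction arbitrary: t' v' rule: eval.induct)
  case (Let \<rho> e1 t1 v1 e2 t2 v2)
  from Let.prems show ?case
    by (rule eval_cases) (auto dest!: Let.IH)
next
  case (Arith \<rho> e1 t1 x e2 t2 y f)
  from Arith.prems show ?case
    by (rule eval_cases) (auto dest!: Arith.IH)
next
  case (IfLess_True \<rho> e1 t1 x e2 t2 y e3 t3 v e4)
  from IfLess_True.prems show ?case
    by (rule eval_cases) (auto dest!: IfLess_True.IH simp: \<open>x < y\<close>)
next
  case (IfLess_False \<rho> e1 t1 x e2 t2 y e4 t4 v e3)
  from IfLess_False.prems show ?case
    by (rule eval_cases) (auto dest!: IfLess_False.IH simp: \<open>\<not> x < y\<close>)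
next
  case (ConsE \<rho> e1 t1 v1 e2 t2 v2)
  from ConsE.prems show ?case
    by (rule eval_cases) (auto dest!: ConsE.IH)
next
  case (CaseList_Nil \<rho> e1 t1 e2 t2 v e3)
  from CaseList_Nil.prems show ?case
    by (rule eval_cases) (auto dest!: CaseList_Nil.IH)
next
  case (CaseList_Cons \<rho> e1 t1 h r e3 t3 v e2)
  from CaseList_Cons.prems show ?case
    by (rule eval_cases) (auto dest!: CaseList_Cons.IH)
next
  case (Call k \<rho> e t1 a t2 v)
  from Call.prems show ?case
    by (rule eval_cases) (auto dest!: Call.IH)
qed (erule eval_cases, simp)+

text \<open>A program consists of function bodies and a main expression, whose only variable is the input.\<close>

type_synonym program = "exp list \<times> exp"

definition runs :: "program \<Rightarrow> val \<Rightarrow> nat \<Rightarrow> val \<Rightarrow> bool" where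
  "runs P a t v \<longleftrightarrow> eval (fst P) [a] (snd P) t v"

definition vlist :: "val list \<Rightarrow> val" where
  "vlist xs = foldr VCons xs VNil"

definition vreals :: "real list \<Rightarrow> val" where
  "vreals xs = vlist (map VNum xs)"

definition vvec :: "nat \<Rightarrow> (nat \<Rightarrow> real) \<Rightarrow> val" where
  "vvec m z = vreals (map z [0..<m])"

definition vpoint :: "nat \<Rightarrow> (nat \<Rightarrow> bool) \<Rightarrow> val" where
  "vpoint m \<omega> = vvec m (\<lambda>j. of_bool (\<omega> j))"

definition vsets :: "nat \<Rightarrow> (nat \<Rightarrow> nat set) \<Rightarrow> val" where
  "vsets n A = vlist (map (\<lambda>i. vreals (map real (sorted_list_of_set (A i)))) [0..<n])"

text \<open>
  The events are presented to an algorithm through an arbitrary description \<open>x\<close>. The program \<open>Q\<close>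
  computes the vector of event probabilities from \<open>x\<close> and any vector \<open>z\<close> in time \<open>b(m)\<close>.
\<close>

definition computes_probs ::
    "program \<Rightarrow> nat poly \<Rightarrow> val \<Rightarrow> nat \<Rightarrow> nat \<Rightarrow> (nat \<Rightarrow> (nat \<Rightarrow> bool) set) \<Rightarrow> bool" where
  "computes_probs Q b x m n E \<longleftrightarrow>
     (\<forall>z. unit_vector m z \<longrightarrow>
        (\<exists>t. runs Q (vlist [x, vvec m z]) t (vvec n (event_prob m E z)) \<and> t \<le> poly b m))"

definition instance_input ::
    "val \<Rightarrow> nat \<Rightarrow> nat \<Rightarrow> (nat \<Rightarrow> nat set) \<Rightarrow> (nat \<Rightarrow> real) \<Rightarrow> real \<Rightarrow> val" where
  "instance_input x m n A z \<alpha> =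
     vlist [x, VNum (real m), VNum (real n), vsets n A, vvec m z, VNum \<alpha>]"

end

theory Submission
  imports Defs
begin

text \<open>
  The coordinates are rounded one after the other. Writing \<open>q\<close> for the alternating independence
  polynomial, \<open>q (s * p z)\<close> is affine in every coordinate of \<open>z\<close>, since the events depending on one
  coordinate form a clique. A coordinate is moved to the side where \<open>q\<close> does not decrease by more
  than a constant factor; as \<open>q\<close> stays positive on the way, the vector stays in the Shearer region.
  In every round a factor \<open>1 + \<delta>\<close> of the slack, \<open>\<delta> = \<alpha> / (2 m)\<close>, is given up. This makes
  it possible to approximate the derivative of \<open>q\<close> by a tree recursion of depth
  \<open>O (ln (n m / \<alpha>) / \<surd>\<delta>)\<close>. In the end the probabilities are 0 or 1 and in the Shearer region,
  hence 0.
\<close>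

section \<open>Positivity in the Shearer region\<close>

text \<open>\<open>q\<close> sums over exponentially many independent sets, so neither it nor its
  derivative is evaluated. Divided by \<open>q V\<close>, the derivative becomes a sum over events
  of the change in probability times a quotient of two values of \<open>q\<close>, and such
  quotients satisfy a recursion over neighbours. Their estimates may give the derivative the wrong
  sign. This is affordable: the slack bounds each probability times its quotient by 1/\<delta>, so a
  relative error of \<delta>/(2n) in the quotients lets a wrong choice at most halve
  \<open>q V\<close>. The same slack permits truncation. Scaling all probabilities by 1+\<delta>
  changes the ratios by more than the truncation error, with a gain of 1+h per level if h^2 \<le>
  2\<delta>; hence h = 1/k with k the rounded-up root of m/\<alpha>. The value \<delta> =
  \<alpha>/(2m) is small enough for (1+\<delta>)^m \<le> exp(\<alpha>/2) < 1+\<alpha>, so slack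
  remains after m rounds. The machine model has no roots or logarithms. Therefore k is found by
  search, and the depth is controlled by a weight \<open>w\<close> that is divided by 1+h at each
  descent and stops the recursion below 1.\<close>

lemma independent_in_mono: "independent_in S adj I \<Longrightarrow> S \<subseteq> T \<Longrightarrow> independent_in T adj I"
  by (auto simp: independent_in_def)

lemma finite_independent_in: "finite S \<Longrightarrow> finite {I. independent_in S adj I}"
  by (rule finite_subset[of _ "Pow S"]) (auto simp: independent_in_def)

definition shearer_poly :: "('a \<Rightarrow> 'a \<Rightarrow> bool) \<Rightarrow> ('a \<Rightarrow> real) \<Rightarrow> 'a set \<Rightarrow> real" where
  "shearer_poly adj p S = (\<Sum>I | independent_in S adj I. \<Prod>v\<in>I. - p v)"

text \<open>The real characterisation of the Shearer region by induced subgraphs. In a simple graph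
  the upper bound on \<open>p v\<close> is contained in it, as the polynomial of \<open>{v}\<close>
  is \<open>1 - p v\<close>.\<close>

definition positive_region :: "('a \<Rightarrow> 'a \<Rightarrow> bool) \<Rightarrow> 'a set \<Rightarrow> ('a \<Rightarrow> real) set" where
  "positive_region adj V = {p. (\<forall>v\<in>V. 0 \<le> p v) \<and> (\<forall>S\<subseteq>V. 0 < shearer_poly adj p S)}"

lemma shearer_poly_cong:
  assumes "\<And>v. v \<in> S \<Longrightarrow> p v = p' v"
  shows "shearer_poly adj p S = shearer_poly adj p' S"
  unfolding shearer_poly_def
  by (intro sum.cong prod.cong refl) (use assms in \<open>auto simp: independent_in_def\<close>)

text \<open>Weight 0 switches off the vertices outside \<open>S\<close>. In this way the condition
  on \<open>V\<close> alone controls all induced subgraphs.\<close>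

lemma shearer_poly_eq_indep_poly:
  assumes "finite V" "S \<subseteq> V"
  shows "complex_of_real (shearer_poly adj p S) =
    indep_poly V adj (\<lambda>v. if v \<in> S then - complex_of_real (p v) else 0)"
proof -
  let ?w = "\<lambda>v. if v \<in> S then - complex_of_real (p v) else 0"
  have "(\<Sum>I | independent_in V adj I. \<Prod>v\<in>I. ?w v) = (\<Sum>I | independent_in S adj I. \<Prod>v\<in>I. ?w v)"
  proof (rule sum.mono_neutral_right)
    show "\<forall>I \<in> {I. independent_in V adj I} - {I. independent_in S adj I}. (\<Prod>v\<in>I. ?w v) = 0"
    proof
      fix I assume I: "I \<in> {I. independent_in V adj I} - {I. independent_in S adj I}"
      then obtain v where "v \<in> I" "v \<notin> S" by (auto simp: independent_in_def)
      moreover have "finite I" using I assms finite_subset by (auto simp: independent_in_def)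
      ultimately show "(\<Prod>v\<in>I. ?w v) = 0" by (intro prod_zero) auto
    qed
  qed (use assms in \<open>auto intro: finite_independent_in independent_in_mono\<close>)
  also have "\<dots> = (\<Sum>I | independent_in S adj I. \<Prod>v\<in>I. - complex_of_real (p v))"
    by (intro sum.cong prod.cong refl) (auto simp: independent_in_def)
  finally show ?thesis by (simp add: indep_poly_def shearer_poly_def)
qed

lemma shearer_poly_zero: "shearer_poly adj (\<lambda>v. 0) S = 1" if "finite S"
proof -
  have "shearer_poly adj (\<lambda>v. 0) S = (\<Sum>I | independent_in S adj I. if I = {} then 1 else 0)"
    unfolding shearer_poly_def
  proof (intro sum.cong refl)
    fix I assume "I \<in> {I. independent_in S adj I}"
    then have "finite I" using that by (auto simp: independent_in_def intro: finite_subset)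
    then show "(\<Prod>v\<in>I. - 0) = (if I = {} then 1 else 0 :: real)" by (auto intro!: prod_zero)
  qed
  also have "\<dots> = 1"
    using that by (subst sum.delta) (auto simp: finite_independent_in independent_in_def)
  finally show ?thesis .
qed

lemma shearer_poly_empty: "shearer_poly adj p {} = 1"
  using shearer_poly_cong[of "{}" p "\<lambda>v. 0" adj] shearer_poly_zero[of "{}" adj] by simp

text \<open>The value is 1 at the origin. If it were not positive at \<open>t * p\<close>, it would
  vanish at some \<open>s * p\<close> with \<open>s \<le> t\<close>, and \<open>- s * p\<close> on
  \<open>S\<close>, extended by 0, would be a zero in the polydisc of radius
  \<open>p\<close>.\<close>

lemma shearer_region_imp_positive:
  assumes "finite V" "p \<in> shearer_region V adj" "0 \<le> t" "t \<le> 1"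
  shows "(\<lambda>v. t * p v) \<in> positive_region adj V"
proof -
  have p: "0 \<le> p v" if "v \<in> V" for v using assms(2) that by (auto simp: shearer_region_def)
  have "0 < shearer_poly adj (\<lambda>v. t * p v) S" if "S \<subseteq> V" for S
  proof (rule ccontr)
    assume neg: "\<not> ?thesis"
    have fin: "finite S" using that assms(1) finite_subset by blast
    have "continuous_on {0..t} (\<lambda>s. shearer_poly adj (\<lambda>v. s * p v) S)"
      unfolding shearer_poly_def by (intro continuous_intros)
    moreover have "shearer_poly adj (\<lambda>v. 0 * p v) S \<ge> 0" using shearer_poly_zero[OF fin] by simp
    ultimately obtain s where s: "0 \<le> s" "s \<le> t" "shearer_poly adj (\<lambda>v. s * p v) S = 0"
      using IVT2'[of "\<lambda>s. shearer_poly adj (\<lambda>v. s * p v) S" t 0 0] neg assms(3) by auto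
    have "cmod (if v \<in> S then - complex_of_real (s * p v) else 0) \<le> p v" if "v \<in> V" for v
      using p[OF that] s assms(4) mult_right_mono[of s 1 "p v"] by (auto simp: norm_mult)
    then have "indep_poly V adj (\<lambda>v. if v \<in> S then - complex_of_real (s * p v) else 0) \<noteq> 0"
      using assms(2) by (simp add: shearer_region_def)
    then show False using shearer_poly_eq_indep_poly[OF assms(1) that, of adj "\<lambda>v. s * p v"] s by simp
  qed
  then show ?thesis using p assms by (simp add: positive_region_def)
qed

section \<open>Recurrences of the alternating polynomial and moves within a clique\<close>

locale simple_graph =
  fixes adj :: "'a \<Rightarrow> 'a \<Rightarrow> bool"
  assumes adj_sym: "adj u v \<Longrightarrow> adj v u" and adj_irrefl: "\<not> adj v v"
begin

abbreviation "q \<equiv> shearer_poly adj"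

lemma q_insert:
  assumes "finite S" "u \<notin> S"
  shows "q p (insert u S) = q p S - p u * q p {v \<in> S. \<not> adj u v}"
proof -
  let ?J = "{I. independent_in {v \<in> S. \<not> adj u v} adj I}"
  have eq: "{I. independent_in (insert u S) adj I} = {I. independent_in S adj I} \<union> insert u ` ?J"
  proof (intro equalityI subsetI)
    fix I assume I: "I \<in> {I. independent_in (insert u S) adj I}"
    show "I \<in> {I. independent_in S adj I} \<union> insert u ` ?J"
    proof (cases "u \<in> I")
      case True
      then have "I = insert u (I - {u})" "I - {u} \<in> ?J" using I by (auto simp: independent_in_def)
      then show ?thesis by blast
    qed (use I in \<open>auto simp: independent_in_def\<close>)
  qed (use adj_sym adj_irrefl in \<open>auto simp: independent_in_def\<close>)
  have inj: "inj_on (insert u) ?J"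
    by (rule inj_on_inverseI[of _ "\<lambda>I. I - {u}"]) (use assms in \<open>auto simp: independent_in_def\<close>)
  have "q p (insert u S) = q p S + (\<Sum>I\<in>insert u ` ?J. \<Prod>v\<in>I. - p v)"
    unfolding shearer_poly_def eq using assms
    by (intro sum.union_disjoint finite_imageI finite_independent_in) (auto simp: independent_in_def)
  also have "(\<Sum>I\<in>insert u ` ?J. \<Prod>v\<in>I. - p v) = (\<Sum>I\<in>?J. - p u * (\<Prod>v\<in>I. - p v))"
    unfolding sum.reindex[OF inj] o_def
  proof (intro sum.cong refl)
    fix I assume "I \<in> ?J"
    then have "finite I" "u \<notin> I" using assms by (auto simp: independent_in_def intro: finite_subset)
    then show "(\<Prod>v\<in>insert u I. - p v) = - p u * (\<Prod>v\<in>I. - p v)" by simp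
  qed
  also have "\<dots> = - p u * q p {v \<in> S. \<not> adj u v}" by (simp add: shearer_poly_def sum_distrib_left)
  finally show ?thesis by simp
qed

text \<open>By \<open>q_insert\<close> every added vertex subtracts a nonnegative term. Mere
  nonnegativity is assumed since the lemma is applied at a boundary point, where some
  \<open>q S\<close> vanishes.\<close>

lemma q_antimono:
  assumes "finite V" "\<And>v. v \<in> V \<Longrightarrow> 0 \<le> p v" "\<And>S. S \<subseteq> V \<Longrightarrow> 0 \<le> q p S" "S \<subseteq> V"
  shows "q p V \<le> q p S"
proof -
  have "q p (S \<union> T) \<le> q p S" if "finite T" "T \<subseteq> V - S" for T
    using that
  proof (induction T)
    case (insert u T)
    have "q p (S \<union> insert u T) = q p (S \<union> T) - p u * q p {v \<in> S \<union> T. \<not> adj u v}"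
      using q_insert[of "S \<union> T" u p] insert.hyps insert.prems finite_subset[OF assms(4,1)] by auto
    moreover have "0 \<le> p u * q p {v \<in> S \<union> T. \<not> adj u v}"
      using insert.prems assms(4) by (intro mult_nonneg_nonneg assms) auto
    ultimately show ?case using insert by auto
  qed auto
  from this[of "V - S"] show ?thesis using assms(1,4) by (auto simp: Un_absorb1)
qed

lemma q_clique:
  assumes "finite V" "C \<subseteq> V" "\<And>i j. i \<in> C \<Longrightarrow> j \<in> C \<Longrightarrow> i \<noteq> j \<Longrightarrow> adj i j"
  shows "q p V = q p (V - C) - (\<Sum>i\<in>C. p i * q p {v \<in> V - {i}. \<not> adj i v})"
proof -
  have "finite C" by (rule finite_subset[OF assms(2,1)])
  then show ?thesis using assms(2,3)
  proof (induction C)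
    case (insert c C)
    \<comment> \<open>The nonneighbours of \<open>c\<close> avoid the rest of the clique, so they
      are the same before and after its removal.\<close>
    have eq: "{v \<in> V - insert c C. \<not> adj c v} = {v \<in> V - {c}. \<not> adj c v}"
      using insert.prems(2)[of c] insert.hyps by blast
    have "q p (insert c (V - insert c C)) =
        q p (V - insert c C) - p c * q p {v \<in> V - {c}. \<not> adj c v}"
      using q_insert[of "V - insert c C" c p] assms(1) unfolding eq by simp
    moreover have "insert c (V - insert c C) = V - C" using insert.hyps insert.prems(1) by auto
    moreover have "q p V = q p (V - C) - (\<Sum>i\<in>C. p i * q p {v \<in> V - {i}. \<not> adj i v})"
      by (rule insert.IH) (use insert.prems in simp_all)
    ultimately show ?case using insert.hyps by simp
  qed simp
qed

text \<open>For \<open>i\<close> in the clique the set of nonneighbours avoids \<open>C\<close>, so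
  the coefficients in \<open>q_clique\<close> agree at \<open>p\<close> and \<open>p'\<close>. The
  intersection \<open>V \<inter> C\<close> appears because \<open>C\<close> will be the set of all
  indices \<open>i\<close> with \<open>j \<in> A i\<close>, inside \<open>V\<close> or not.\<close>

lemma q_clique_affine:
  assumes "finite V" "\<And>i j. i \<in> C \<Longrightarrow> j \<in> C \<Longrightarrow> i \<noteq> j \<Longrightarrow> adj i j"
    and "\<And>v. v \<in> V - C \<Longrightarrow> p' v = p v"
  shows "q p' V = q p V - (\<Sum>i\<in>V \<inter> C. (p' i - p i) * q p {v \<in> V - {i}. \<not> adj i v})"
proof -
  have 1: "q p' (V - V \<inter> C) = q p (V - V \<inter> C)"
    by (rule shearer_poly_cong) (use assms(3) in auto)
  have 2: "q p' {v \<in> V - {i}. \<not> adj i v} = q p {v \<in> V - {i}. \<not> adj i v}" if "i \<in> V \<inter> C" for i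
    by (rule shearer_poly_cong) (use assms(2,3) that in auto)
  have 3: "q r V = q r (V - V \<inter> C) - (\<Sum>i\<in>V \<inter> C. r i * q r {v \<in> V - {i}. \<not> adj i v})" for r
    using assms(1,2) by (intro q_clique) auto
  show ?thesis
    unfolding 3[of p'] 3[of p] 1 using 2 by (simp add: sum_subtractf algebra_simps)
qed

text \<open>On the segment from \<open>p\<close> to \<open>p'\<close> every \<open>q S\<close> is affine. At the first point where
  some \<open>q S\<close> vanishes all of them are still nonnegative, so \<open>q V \<le> q S = 0\<close> there.\<close>

lemma positive_region_clique_move:
  assumes "finite V" and C: "\<And>i j. i \<in> C \<Longrightarrow> j \<in> C \<Longrightarrow> i \<noteq> j \<Longrightarrow> adj i j"
    and off: "\<And>v. v \<in> V - C \<Longrightarrow> p' v = p v"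
    and p: "p \<in> positive_region adj V" and p': "\<And>v. v \<in> V \<Longrightarrow> 0 \<le> p' v" "0 < q p' V"
  shows "p' \<in> positive_region adj V"
proof (rule ccontr)
  define r where "r t v = (1 - t) * p v + t * p' v" for t v
  have pos: "0 < q p S" if "S \<subseteq> V" for S using p that by (auto simp: positive_region_def)
  have r: "q (r t) S = (1 - t) * q p S + t * q p' S" if "S \<subseteq> V" for t S
  proof -
    have fin: "finite S" using that assms(1) finite_subset by blast
    have "q (r t) S = q p S - (\<Sum>i\<in>S \<inter> C. (r t i - p i) * q p {v \<in> S - {i}. \<not> adj i v})"
      by (rule q_clique_affine[OF fin C]) (use off that in \<open>auto simp: r_def algebra_simps\<close>)
    also have "\<dots> = q p S - t * (\<Sum>i\<in>S \<inter> C. (p' i - p i) * q p {v \<in> S - {i}. \<not> adj i v})"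
      by (simp add: r_def sum_distrib_left algebra_simps)
    also have "(\<Sum>i\<in>S \<inter> C. (p' i - p i) * q p {v \<in> S - {i}. \<not> adj i v}) = q p S - q p' S"
      using q_clique_affine[of S C p' p, OF fin C] off that by fastforce
    finally show ?thesis by (simp add: algebra_simps)
  qed
  \<comment> \<open>\<open>B\<close> collects the sets that lose positivity on the way, and
    \<open>root S\<close> is the zero of the affine function \<open>q (r t) S\<close> of
    \<open>t\<close>.\<close>
  define B where "B = {S. S \<subseteq> V \<and> q p' S \<le> 0}"
  define root where "root S = q p S / (q p S - q p' S)" for S
  assume "p' \<notin> positive_region adj V"
  then have "B \<noteq> {}" using p' by (auto simp: positive_region_def B_def not_less)
  moreover have "finite B" using assms(1) by (auto simp: B_def)
  ultimately obtain S where S: "S \<in> B" "\<And>T. T \<in> B \<Longrightarrow> root S \<le> root T"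
    using arg_min_least[of B _ root] arg_min_if_finite(1)[of B root] by blast
  define t where "t = root S"
  have S': "S \<subseteq> V" "q p' S \<le> 0" using S by (auto simp: B_def)
  have t: "0 < t" "t \<le> 1" using pos[OF S'(1)] S' by (auto simp: t_def root_def field_simps)
  have zero: "q (r t) S = 0" unfolding r[OF S'(1)]
    using pos[OF S'(1)] S' by (simp add: t_def root_def field_simps)
  have nonneg: "0 \<le> q (r t) T" if "T \<subseteq> V" for T
  proof (cases "T \<in> B")
    case True
    then have le: "t \<le> root T" and T: "q p' T \<le> 0" using S by (auto simp: t_def B_def)
    have "t * (q p T - q p' T) \<le> q p T"
      using le pos[OF that] T by (simp add: root_def pos_le_divide_eq)
    then show ?thesis unfolding r[OF that] by (simp add: algebra_simps)
  next
    case False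
    then show ?thesis unfolding r[OF that] using pos[OF that] t that
      by (intro add_nonneg_nonneg mult_nonneg_nonneg) (auto simp: B_def not_le)
  qed
  have "q (r t) V \<le> q (r t) S"
    using p t p' S' nonneg by (intro q_antimono assms) (auto simp: r_def positive_region_def)
  moreover have "0 < q (r t) V" unfolding r[OF order_refl] using p' pos[of V] t
    by (intro add_nonneg_pos mult_nonneg_nonneg mult_pos_pos) auto
  ultimately show False using zero by simp
qed

end

section \<open>Truncated tree recursion\<close>

text \<open>Scaling turns the factor \<open>1 - u\<close> into
  \<open>1 - (1 + \<delta>) * u * exp G\<close>, where \<open>G\<close> is the logarithmic loss in
  the denominator of \<open>u\<close>. The quotient is \<open>1 - a * F\<close> with a = u/(1-u),
  and its negative logarithm is at least \<open>a * F\<close>. Now exp G \<ge> 1+G+G^2/2 and h*G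
  \<le> h^2/2+G^2/2 give \<open>F \<ge> (1 + h) * G\<close>; this is the origin of the root of
  \<delta>. The last two bounds hold because \<open>(1 + \<delta>) * u < 1\<close> keeps 1-u above
  \<delta>/(1+\<delta>).\<close>

lemma log_ratio_step:
  fixes u G \<delta> h :: real
  assumes "0 \<le> u" "0 \<le> G" "0 < \<delta>" "0 \<le> h" "h\<^sup>2 \<le> 2 * \<delta>" "(1 + \<delta>) * u * exp G < 1"
  shows "u / (1 - u) * ((1 + h) * G) \<le> ln ((1 - u) / (1 - (1 + \<delta>) * u * exp G))"
    and "u / (1 - u) * \<delta> \<le> ln ((1 - u) / (1 - (1 + \<delta>) * u * exp G))"
    and "u / (1 - u) * G \<le> 1 / \<delta>"
    and "u / (1 - u) \<le> 1 / \<delta>"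
proof -
  define F where "F = (1 + \<delta>) * exp G - 1"
  have exp1: "1 + G + G\<^sup>2 / 2 \<le> exp G" using exp_lower_Taylor_quadratic[OF assms(2)] by simp
  have "0 \<le> (G - h)\<^sup>2" by simp
  then have "h * G \<le> \<delta> + G\<^sup>2 / 2" using assms(5) by (simp add: power2_eq_square algebra_simps)
  moreover have "\<delta> * 1 \<le> \<delta> * exp G" using assms by (intro mult_left_mono) auto
  ultimately have F1: "(1 + h) * G \<le> F" using exp1 unfolding F_def by (simp add: algebra_simps)
  have F2: "\<delta> \<le> F" unfolding F_def using \<open>\<delta> * 1 \<le> \<delta> * exp G\<close> exp_ge_add_one_self[of G] assms(2)
    unfolding distrib_right by linarith
  have u': "u * exp G < 1 / (1 + \<delta>)" using assms by (simp add: field_simps)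
  have ule: "u \<le> u * exp G" using assms mult_left_mono[of 1 "exp G" u] by simp
  have "(1 + \<delta>) * u \<le> (1 + \<delta>) * (u * exp G)" using ule assms by (intro mult_left_mono) auto
  then have ud: "(1 + \<delta>) * u < 1" using assms(6) unfolding mult.assoc by linarith
  have u1: "u < 1" using ud mult_nonneg_nonneg[of \<delta> u] assms(1,3) unfolding distrib_right by linarith
  have div: "(1 - (1 + \<delta>) * u * exp G) / (1 - u) = 1 - u / (1 - u) * F"
    using u1 by (simp add: F_def field_simps)
  have pos: "0 < 1 - (1 + \<delta>) * u * exp G" using assms by simp
  have "ln (1 - u / (1 - u) * F) \<le> - (u / (1 - u) * F)"
    using ln_add_one_self_le_self2[of "- (u / (1 - u) * F)"] div pos u1
    by (smt (verit) divide_pos_pos)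
  then have "u / (1 - u) * F \<le> - ln ((1 - (1 + \<delta>) * u * exp G) / (1 - u))" unfolding div by simp
  also have "\<dots> = ln ((1 - u) / (1 - (1 + \<delta>) * u * exp G))"
    using pos u1 by (simp add: ln_div)
  finally have *: "u / (1 - u) * F \<le> ln ((1 - u) / (1 - (1 + \<delta>) * u * exp G))" .
  have a0: "0 \<le> u / (1 - u)" using assms u1 by simp
  show "u / (1 - u) * ((1 + h) * G) \<le> ln ((1 - u) / (1 - (1 + \<delta>) * u * exp G))"
    using mult_left_mono[OF F1 a0] * by linarith
  show "u / (1 - u) * \<delta> \<le> ln ((1 - u) / (1 - (1 + \<delta>) * u * exp G))"
    using mult_left_mono[OF F2 a0] * by linarith
  have d: "\<delta> * u \<le> 1 - u" using ud by (simp add: algebra_simps)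
  then show "u / (1 - u) \<le> 1 / \<delta>" using u1 assms by (simp add: field_simps)
  have "G \<le> exp G" using exp_ge_add_one_self[of G] by linarith
  then have "u * G \<le> 1 / (1 + \<delta>)" using u' assms mult_left_mono[of G "exp G" u] by linarith
  moreover have "\<delta> / (1 + \<delta>) \<le> 1 - u" using ud assms by (simp add: field_simps)
  ultimately have "u * G / (1 - u) \<le> (1 / (1 + \<delta>)) / (\<delta> / (1 + \<delta>))"
    using assms by (intro frac_le) auto
  then show "u / (1 - u) * G \<le> 1 / \<delta>" using assms by (simp add: field_simps)
qed

text \<open>Overestimating the denominator of \<open>u\<close> by a factor exp E changes
  \<open>1 - u\<close> to \<open>1 - u * exp (- E)\<close>. The quotient is 1 + a*(1 - exp(-E)) with
  a = u/(1-u), and tangent bounds for the logarithm and the exponential finish.\<close>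

lemma ln_truncated_step:
  fixes u E :: real
  assumes "0 \<le> u" "u < 1" "0 \<le> E"
  shows "0 \<le> ln ((1 - u * exp (- E)) / (1 - u))" "ln ((1 - u * exp (- E)) / (1 - u)) \<le> u / (1 - u) * E"
proof -
  have e: "exp (- E) \<le> 1" "1 - E \<le> exp (- E)" using assms exp_ge_add_one_self[of "- E"] by auto
  have eq: "(1 - u * exp (- E)) / (1 - u) = 1 + u / (1 - u) * (1 - exp (- E))"
    using assms by (simp add: field_simps)
  have nn: "0 \<le> u / (1 - u) * (1 - exp (- E))" using assms e by auto
  show "0 \<le> ln ((1 - u * exp (- E)) / (1 - u))" unfolding eq using nn by simp
  have "ln ((1 - u * exp (- E)) / (1 - u)) \<le> u / (1 - u) * (1 - exp (- E))"
    unfolding eq using nn ln_add_one_self_le_self by blast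
  also have "\<dots> \<le> u / (1 - u) * E" using assms e by (intro mult_left_mono) auto
  finally show "ln ((1 - u * exp (- E)) / (1 - u)) \<le> u / (1 - u) * E" .
qed

text \<open>The relative bound, by the logarithmic change under scaling, is the one that propagates
  from level to level. It is useless at the root, where the scaled factor may be close to 0; the
  absolute bound serves there, and in the untruncated case it follows from the relative bound one
  level below.\<close>

lemma vertex_step:
  fixes P \<pi> \<pi>' \<delta> h w :: real
  assumes "0 \<le> P" "0 < \<pi>'" "\<pi>' \<le> \<pi>" "0 < \<delta>" "\<delta> \<le> 1" "0 \<le> h" "h\<^sup>2 \<le> 2 * \<delta>" "0 < w"
    and pos: "0 < 1 - (1 + \<delta>) * P / \<pi>'"
    and r: "w < 1 \<and> r = 1 \<or>
      (\<exists>Y\<ge>\<pi>. ln (Y / \<pi>) \<le> ln (\<pi> / \<pi>') / (\<delta> * (w / (1 + h))) \<and> r = 1 - P / Y)"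
  shows "1 - P / \<pi> \<le> r"
    and "ln (r / (1 - P / \<pi>)) \<le> ln ((1 - P / \<pi>) / (1 - (1 + \<delta>) * P / \<pi>')) / (\<delta> * w)"
    and "ln (r / (1 - P / \<pi>)) \<le> (1 + h) / (\<delta>\<^sup>2 * w)"
proof -
  define u where "u = P / \<pi>"
  define G where "G = ln (\<pi> / \<pi>')"
  have \<pi>: "0 < \<pi>" using assms by linarith
  have u0: "0 \<le> u" using assms \<pi> by (simp add: u_def)
  have G0: "0 \<le> G" using assms \<pi> by (simp add: G_def)
  have eG: "(1 + \<delta>) * u * exp G = (1 + \<delta>) * P / \<pi>'"
    using assms \<pi> by (simp add: u_def G_def field_simps)
  have lt: "(1 + \<delta>) * u * exp G < 1" unfolding eG using pos by simp
  note st = log_ratio_step[OF u0 G0 assms(4,6,7) lt]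
  define a where "a = u / (1 - u)"
  have "u \<le> u * exp G" using u0 G0 mult_left_mono[of 1 "exp G" u] by simp
  moreover have "u * exp G \<le> (1 + \<delta>) * (u * exp G)" using u0 assms by (simp add: distrib_right)
  ultimately have u1: "u < 1" using lt by (simp add: algebra_simps)
  have a0: "0 \<le> a" using u0 u1 by (simp add: a_def)
  define \<Delta> where "\<Delta> = ln ((1 - u) / (1 - (1 + \<delta>) * u * exp G))"
  note st' = st[folded \<Delta>_def a_def]
  have goal: "1 - u \<le> r \<and> ln (r / (1 - u)) \<le> \<Delta> / (\<delta> * w) \<and> ln (r / (1 - u)) \<le> (1 + h) / (\<delta>\<^sup>2 * w)"
    using r
  proof
    \<comment> \<open>A truncated factor has error \<open>ln (1 + a) \<le> a\<close>, which
      \<open>a * \<delta> \<le> \<Delta>\<close> and \<open>w < 1\<close> pay for. Hence the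
      denominator \<open>\<delta> * w\<close> in the bounds.\<close>
    assume w: "w < 1 \<and> r = 1"
    have "ln (r / (1 - u)) = ln (1 + a)" using w u1 by (simp add: a_def field_simps)
    also have "\<dots> \<le> a" using a0 by (rule ln_add_one_self_le_self)
    finally have le: "ln (r / (1 - u)) \<le> a" .
    have "a * \<delta> * w \<le> a * \<delta> * 1" using w a0 assms by (intro mult_left_mono) auto
    then have "a * (\<delta> * w) \<le> \<Delta>" using st'(2) unfolding mult.assoc by linarith
    then have 1: "a \<le> \<Delta> / (\<delta> * w)" using assms(4,8) by (simp add: pos_le_divide_eq)
    have "a * \<delta> * (\<delta> * w) \<le> 1 * (1 * 1)"
      using st'(4) assms w a0 by (intro mult_mono) (auto simp: field_simps)
    then have 2: "a \<le> (1 + h) / (\<delta>\<^sup>2 * w)" using assms by (simp add: field_simps power2_eq_square)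
    show ?thesis using le 1 2 w u0 by auto
  next
    assume "\<exists>Y\<ge>\<pi>. ln (Y / \<pi>) \<le> ln (\<pi> / \<pi>') / (\<delta> * (w / (1 + h))) \<and> r = 1 - P / Y"
    then obtain Y where Y: "\<pi> \<le> Y" "ln (Y / \<pi>) \<le> G / (\<delta> * (w / (1 + h)))" "r = 1 - P / Y"
      by (auto simp: G_def)
    define E where "E = ln (Y / \<pi>)"
    have E0: "0 \<le> E" using Y \<pi> by (simp add: E_def)
    have r: "r = 1 - u * exp (- E)" using Y \<pi> by (simp add: E_def u_def exp_minus field_simps)
    have 1: "ln (r / (1 - u)) \<le> a * E" unfolding r a_def by (rule ln_truncated_step[OF u0 u1 E0])
    also have "\<dots> \<le> a * (G / (\<delta> * (w / (1 + h))))" using Y a0 by (intro mult_left_mono) (auto simp: E_def)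
    \<comment> \<open>The smaller weight \<open>w / (1 + h)\<close> of the next level costs the
      factor \<open>1 + h\<close> that \<open>log_ratio_step\<close> gains on
      \<open>G\<close>.\<close>
    also have "\<dots> = a * ((1 + h) * G) / (\<delta> * w)" using assms by (simp add: field_simps)
    finally have 2: "ln (r / (1 - u)) \<le> a * ((1 + h) * G) / (\<delta> * w)" .
    have "a * ((1 + h) * G) / (\<delta> * w) \<le> \<Delta> / (\<delta> * w)"
      using st'(1) assms by (intro divide_right_mono) auto
    moreover have "a * ((1 + h) * G) / (\<delta> * w) = (1 + h) * (a * G) / (\<delta> * w)" by simp
    moreover have "\<dots> \<le> (1 + h) * (1 / \<delta>) / (\<delta> * w)"
      using st'(3) assms by (intro divide_right_mono mult_left_mono) auto
    moreover have "(1 + h) * (1 / \<delta>) / (\<delta> * w) = (1 + h) / (\<delta>\<^sup>2 * w)" by (simp add: power2_eq_square)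
    moreover have "u * exp (- E) \<le> u * 1" using u0 E0 by (intro mult_left_mono) auto
    ultimately show ?thesis using 2 r by linarith
  qed
  show "1 - P / \<pi> \<le> r" using goal by (simp add: u_def)
  show "ln (r / (1 - P / \<pi>)) \<le> ln ((1 - P / \<pi>) / (1 - (1 + \<delta>) * P / \<pi>')) / (\<delta> * w)"
    using goal unfolding \<Delta>_def eG by (simp add: u_def)
  show "ln (r / (1 - P / \<pi>)) \<le> (1 + h) / (\<delta>\<^sup>2 * w)" using goal by (simp add: u_def)
qed

section \<open>The truncated recursion and its accuracy\<close>

text \<open>Approximates \<open>q p (N \<union> M) / q p M\<close>. The vertices of \<open>N\<close>
  join \<open>M\<close> one at a time, and the factor for \<open>v\<close> is 1 minus
  \<open>p v\<close> over a ratio of the same kind, taken over the neighbours of \<open>v\<close> in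
  \<open>M\<close>. Only the descent to these neighbours divides \<open>w\<close> by
  \<open>g\<close>. Truncated factors become 1, and since \<open>1 - p v / Y\<close> grows with
  \<open>Y\<close>, all errors point upwards.\<close>

function (sequential) tree_ratio ::
    "('a \<Rightarrow> 'a \<Rightarrow> bool) \<Rightarrow> ('a \<Rightarrow> real) \<Rightarrow> real \<Rightarrow> 'a list \<Rightarrow> 'a list \<Rightarrow> real \<Rightarrow> real" where
  "tree_ratio adj p g [] M w = 1"
| "tree_ratio adj p g (v # N) M w =
    (if w < 1 then 1
     else 1 - p v / tree_ratio adj p g (filter (adj v) M) (filter (\<lambda>u. \<not> adj v u) M) (w / g)) *
    tree_ratio adj p g N (v # M) w"
  by pat_completeness auto
termination
  by (relation "measures [\<lambda>(adj, p, g, N, M, w). length N + length M, \<lambda>(adj, p, g, N, M, w). length N]")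
    (auto simp: sum_length_filter_compl)

lemma tree_ratio_induct [case_names Nil Cons]:
  assumes "\<And>M w. P [] M w"
    and "\<And>v N M w. (\<not> w < 1 \<Longrightarrow> P (filter (adj v) M) (filter (\<lambda>u. \<not> adj v u) M) (w / g)) \<Longrightarrow>
      P N (v # M) w \<Longrightarrow> P (v # N) M w"
  shows "P N M (w :: real)"
proof -
  have "g' = g \<Longrightarrow> adj' = adj \<Longrightarrow> P N M w" for adj' and g' :: real and p :: "'a \<Rightarrow> real"
    by (induction adj' p g' N M w rule: tree_ratio.induct) (simp_all add: assms)
  then show ?thesis by simp
qed

context simple_graph
begin

lemma q_insert_ratio:
  assumes "finite M" "v \<notin> M" "0 < q p M"
  shows "q p (insert v M) / q p M = 1 - p v / (q p M / q p {u \<in> M. \<not> adj v u})"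
  using q_insert[OF assms(1,2), of p] assms(3) by (simp add: field_simps)

text \<open>Positivity and monotonicity need each other, so they share an induction on the size of
  the union. A one-vertex ratio is 1 minus \<open>p v\<close> over a ratio on fewer vertices;
  compared with \<open>p'\<close>, the numerator is smaller and the denominator larger. The ratio is
  thus at least the positive one at \<open>p'\<close>. Several vertices telescope.\<close>

lemma q_ratio_antimono:
  assumes V: "finite V" and p': "p' \<in> positive_region adj V"
    and p: "\<And>v. v \<in> V \<Longrightarrow> 0 \<le> p v" "\<And>v. v \<in> V \<Longrightarrow> p v \<le> p' v"
  shows "S \<union> T \<subseteq> V \<Longrightarrow> 0 < q p (S \<union> T) \<and> q p' (S \<union> T) / q p' T \<le> q p (S \<union> T) / q p T"
proof (induction "card (S \<union> T)" arbitrary: S T rule: less_induct)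
  case less
  have fin: "finite (S \<union> T)" using less.prems V finite_subset by blast
  have pos': "0 < q p' U" if "U \<subseteq> V" for U using p' that by (auto simp: positive_region_def)
  have small: "0 < q p U" if "U \<subset> S \<union> T" for U
    using less.hyps[of "{}" U] psubset_card_mono[OF fin that] that less.prems by auto
  have step: "0 < q p (insert v M) \<and> q p' (insert v M) / q p' M \<le> q p (insert v M) / q p M"
    if v: "insert v M = S \<union> T" "v \<notin> M" for v M
  proof -
    have M: "M \<subset> S \<union> T" and finM: "finite M" using v fin finite_subset[of M "S \<union> T"] by auto
    define N2 where "N2 = {u \<in> M. adj v u}"
    define M2 where "M2 = {u \<in> M. \<not> adj v u}"
    have NM: "N2 \<union> M2 = M" by (auto simp: N2_def M2_def)
    have vV: "v \<in> V" "M \<subseteq> V" "M2 \<subseteq> V" using v less.prems by (auto simp: M2_def)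
    have qp: "0 < q p M" "0 < q p M2" "0 < q p' M" "0 < q p' M2"
      using small[of M] small[of M2] M NM pos' vV by auto
    have ih: "q p' M / q p' M2 \<le> q p M / q p M2"
      using less.hyps[of N2 M2] psubset_card_mono[OF fin M] vV unfolding NM by auto
    have "p v / (q p M / q p M2) \<le> p' v / (q p' M / q p' M2)"
      by (rule frac_le[OF _ _ _ ih]) (use p[OF vV(1)] qp in auto)
    then have le: "q p' (insert v M) / q p' M \<le> q p (insert v M) / q p M"
      using q_insert_ratio[OF finM v(2), of p] q_insert_ratio[OF finM v(2), of p'] qp
      unfolding M2_def by simp
    moreover have "0 < q p' (insert v M) / q p' M"
      using pos'[of "insert v M"] qp v less.prems by auto
    ultimately have "0 < q p (insert v M) / q p M" by linarith
    then show ?thesis using le qp by (simp add: zero_less_divide_iff)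
  qed
  have pos: "0 < q p (S \<union> T)"
  proof (cases "S \<union> T = {}")
    case True
    then show ?thesis by (simp add: shearer_poly_empty)
  next
    case False
    then obtain v where "v \<in> S \<union> T" by blast
    then show ?thesis using step[of v "S \<union> T - {v}"] by (simp add: insert_absorb)
  qed
  show ?case
  proof (cases "S \<subseteq> T")
    case True
    then show ?thesis using pos pos'[of T] less.prems by (simp add: Un_absorb1)
  next
    case False
    then obtain v where v: "v \<in> S" "v \<notin> T" by blast
    define M where "M = S - {v} \<union> T"
    have M: "insert v M = S \<union> T" "v \<notin> M" using v by (auto simp: M_def)
    have sub: "M \<subset> S \<union> T" using M by blast
    have 1: "q p' (insert v M) / q p' M \<le> q p (insert v M) / q p M" using step[OF M] by blast
    have 2: "q p' M / q p' T \<le> q p M / q p T"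
      using less.hyps[of "S - {v}" T] psubset_card_mono[OF fin sub] less.prems unfolding M_def by auto
    have qs: "0 < q p M" "0 < q p' M" "0 < q p' (insert v M)" "0 < q p' T"
      using small[OF sub] pos'[of M] pos'[of "insert v M"] pos'[of T] M(1) less.prems sub by auto
    have "q p' (insert v M) / q p' M * (q p' M / q p' T) \<le> q p (insert v M) / q p M * (q p M / q p T)"
      using 1 2 qs pos unfolding M(1) by (intro mult_mono) auto
    then show ?thesis using pos qs M(1) by simp
  qed
qed

lemma positive_region_antimono:
  assumes "finite V" "p' \<in> positive_region adj V"
    and "\<And>v. v \<in> V \<Longrightarrow> 0 \<le> p v" "\<And>v. v \<in> V \<Longrightarrow> p v \<le> p' v"
  shows "p \<in> positive_region adj V"
  using q_ratio_antimono[OF assms, of "{}"] assms(3) by (auto simp: positive_region_def)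

text \<open>The error \<open>\<epsilon> = ln (y / x)\<close> of the truncated recursion is controlled by the logarithmic change
  \<open>\<Delta>\<close> of the ratio when the probabilities are scaled up by \<open>1 + \<delta>\<close>: along one level, \<open>\<epsilon>\<close> is
  multiplied by at most \<open>a = (1 - x) / x\<close>, whereas \<open>\<Delta> \<ge> a ((1 + \<delta>) e\<^sup>G - 1) \<ge> a (1 + h) G\<close>,
  where \<open>G\<close> is the sum of the children's \<open>\<Delta>\<close>. This gains a factor \<open>1 + h\<close> per level with
  \<open>h\<close> of order \<open>\<surd>\<delta>\<close>.\<close>

lemma tree_ratio_bounds:
  assumes V: "finite V" and \<delta>: "0 < \<delta>" "\<delta> \<le> 1" and h: "0 \<le> h" "h\<^sup>2 \<le> 2 * \<delta>"
    and p': "(\<lambda>v. (1 + \<delta>) * p v) \<in> positive_region adj V"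
    and p: "\<And>v. v \<in> V \<Longrightarrow> 0 \<le> p v"
  defines "r S T \<equiv> q p (S \<union> T) / q p T"
    and "r' S T \<equiv> q (\<lambda>v. (1 + \<delta>) * p v) (S \<union> T) / q (\<lambda>v. (1 + \<delta>) * p v) T"
  shows "distinct (N @ M) \<Longrightarrow> set (N @ M) \<subseteq> V \<Longrightarrow> 0 < w \<Longrightarrow>
    r (set N) (set M) \<le> tree_ratio adj p (1 + h) N M w \<and>
    ln (tree_ratio adj p (1 + h) N M w / r (set N) (set M)) \<le>
      ln (r (set N) (set M) / r' (set N) (set M)) / (\<delta> * w) \<and>
    ln (tree_ratio adj p (1 + h) N M w / r (set N) (set M)) \<le> length N * ((1 + h) / (\<delta>\<^sup>2 * w))"
proof (induction N M w rule: tree_ratio_induct[where g = "1 + h" and adj = adj])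
  case (Nil M w)
  let ?p' = "\<lambda>v. (1 + \<delta>) * p v"
  have reg: "p \<in> positive_region adj V"
    using \<delta> p by (intro positive_region_antimono[OF V p']) (auto simp: distrib_right)
  have "0 < q p (set M)" "0 < q ?p' (set M)"
    using reg p' Nil.prems by (auto simp: positive_region_def)
  then show ?case by (simp add: r_def r'_def)
next
  case (Cons v N M w)
  let ?p' = "\<lambda>v. (1 + \<delta>) * p v"
  let ?t = "tree_ratio adj p (1 + h)"
  have reg: "p \<in> positive_region adj V"
    using \<delta> p by (intro positive_region_antimono[OF V p']) (auto simp: distrib_right)
  have pos: "0 < q p S" "0 < q ?p' S" if "S \<subseteq> V" for S
    using reg p' that by (auto simp: positive_region_def)
  define N2 where "N2 = filter (adj v) M"
  define M2 where "M2 = filter (\<lambda>u. \<not> adj v u) M"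
  have set2: "set N2 \<union> set M2 = set M" "set M2 = {u \<in> set M. \<not> adj v u}"
    by (auto simp: N2_def M2_def)
  have sub: "set M \<subseteq> V" "set M2 \<subseteq> V" "insert v (set M) \<subseteq> V" "v \<notin> set M" "0 \<le> p v"
    using Cons.prems p by (auto simp: M2_def)
  define x where "x = q p (insert v (set M)) / q p (set M)"
  define x' where "x' = q ?p' (insert v (set M)) / q ?p' (set M)"
  have x: "x = 1 - p v / r (set N2) (set M2)"
    unfolding x_def r_def set2(1) unfolding set2(2) using pos sub by (intro q_insert_ratio) auto
  have x': "x' = 1 - (1 + \<delta>) * p v / r' (set N2) (set M2)"
    unfolding x'_def r'_def set2(1) unfolding set2(2) using pos sub by (subst q_insert_ratio) auto
  have xpos: "0 < x" "0 < x'" using pos sub by (auto simp: x_def x'_def)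
  have rr: "0 < r' (set N2) (set M2)" "r' (set N2) (set M2) \<le> r (set N2) (set M2)"
  proof -
    show "0 < r' (set N2) (set M2)" unfolding r'_def set2(1) using pos sub by auto
    show "r' (set N2) (set M2) \<le> r (set N2) (set M2)"
      unfolding r'_def r_def using q_ratio_antimono[OF V p', of p "set N2" "set M2"] p \<delta> sub set2(1)
      by (auto simp: distrib_right)
  qed
  define f where "f = (if w < 1 then 1 else 1 - p v / ?t N2 M2 (w / (1 + h)))"
  have f: "w < 1 \<and> f = 1 \<or> (\<exists>Y\<ge>r (set N2) (set M2).
      ln (Y / r (set N2) (set M2)) \<le> ln (r (set N2) (set M2) / r' (set N2) (set M2)) / (\<delta> * (w / (1 + h))) \<and>
      f = 1 - p v / Y)"
  proof (cases "w < 1")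
    case False
    then show ?thesis
      using Cons.IH(1)[folded N2_def M2_def] Cons.prems sub set2(1) h
      by (intro disjI2 exI[of _ "?t N2 M2 (w / (1 + h))"]) (auto simp: f_def N2_def M2_def)
  qed (simp add: f_def)
  have vs: "x \<le> f" "ln (f / x) \<le> ln (x / x') / (\<delta> * w)" "ln (f / x) \<le> (1 + h) / (\<delta>\<^sup>2 * w)"
    unfolding x x' by (rule vertex_step[OF sub(5) rr \<delta> h Cons.prems(3) _ f]; use xpos x' in simp)+
  let ?S = "set N" and ?T = "insert v (set M)"
  have IH: "r ?S ?T \<le> ?t N (v # M) w"
    "ln (?t N (v # M) w / r ?S ?T) \<le> ln (r ?S ?T / r' ?S ?T) / (\<delta> * w)"
    "ln (?t N (v # M) w / r ?S ?T) \<le> length N * ((1 + h) / (\<delta>\<^sup>2 * w))"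
    using Cons.IH(2) Cons.prems by auto
  have NT: "?S \<union> ?T \<subseteq> V" "set (v # N) \<union> set M = ?S \<union> ?T" using Cons.prems by auto
  have rpos: "0 < r ?S ?T" "0 < r' ?S ?T" using pos sub NT by (auto simp: r_def r'_def)
  \<comment> \<open>The exact and the scaled ratios factor like \<open>tree_ratio\<close>, so errors
    and logarithmic changes both add up; only the absolute bound picks up the count
    \<open>length N\<close>.\<close>
  have split: "r (set (v # N)) (set M) = x * r ?S ?T" "r' (set (v # N)) (set M) = x' * r' ?S ?T"
    unfolding r_def r'_def x_def x'_def NT(2) using pos[of ?T] sub by auto
  have t: "?t (v # N) M w = f * ?t N (v # M) w" by (simp add: f_def N2_def M2_def)
  have pos2: "0 < f" "0 < ?t N (v # M) w" using vs(1) xpos IH(1) rpos by linarith+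
  have "x * r ?S ?T \<le> f * ?t N (v # M) w" using vs IH xpos rpos pos2 by (intro mult_mono) auto
  moreover have "ln (f * ?t N (v # M) w / (x * r ?S ?T)) = ln (f / x) + ln (?t N (v # M) w / r ?S ?T)"
    using pos2 xpos rpos by (simp add: ln_mult ln_div)
  moreover have "ln (x * r ?S ?T / (x' * r' ?S ?T)) = ln (x / x') + ln (r ?S ?T / r' ?S ?T)"
    using pos2 xpos rpos by (simp add: ln_mult ln_div)
  ultimately show ?case
    unfolding t split using vs(2,3) IH(2,3) by (simp add: add_divide_distrib distrib_right)
qed

end

section \<open>Choice of a direction\<close>

context simple_graph
begin

text \<open>By \<open>q_insert\<close>, \<open>\<rho> = 1 / (\<pi> - p i)\<close> where
  \<open>\<pi>\<close> is a ratio that \<open>tree_ratio\<close> estimates. The subtraction could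
  ruin the relative accuracy, but the slack yields \<open>\<delta> * p i \<le> \<pi> - p i\<close>,
  so cancellation costs at most a factor of order 1/\<delta>.\<close>

lemma vertex_weight_bounds:
  fixes L :: "'a list"
  assumes V: "finite V" and \<delta>: "0 < \<delta>" "\<delta> \<le> 1" and h: "0 \<le> h" "h \<le> 1" "h\<^sup>2 \<le> 2 * \<delta>"
    and p': "(\<lambda>v. (1 + \<delta>) * p v) \<in> positive_region adj V"
    and p: "\<And>v. v \<in> V \<Longrightarrow> 0 \<le> p v"
    and L: "distinct L" "set L = V - {i}" "i \<in> V"
    and w: "w = 16 * (real (card V))\<^sup>2 / \<delta> ^ 4"
  defines "\<rho> \<equiv> q p {v \<in> V - {i}. \<not> adj i v} / q p V"
    and "y \<equiv> tree_ratio adj p (1 + h) (filter (adj i) L) (filter (\<lambda>u. \<not> adj i u) L) w - p i"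
  shows "0 < \<rho>" "0 < y" "1 / y \<le> \<rho>" "\<rho> \<le> (1 + \<delta> / (2 * real (card V))) * (1 / y)" "p i * \<rho> \<le> 1 / \<delta>"
proof -
  let ?p' = "\<lambda>v. (1 + \<delta>) * p v"
  define M where "M = {v \<in> V - {i}. \<not> adj i v}"
  define n where "n = real (card V)"
  have n1: "1 \<le> n" using V L(3) by (auto simp: n_def Suc_le_eq card_gt_0_iff)
  have reg: "p \<in> positive_region adj V"
    using \<delta> p by (intro positive_region_antimono[OF V p']) (auto simp: distrib_right)
  have pos: "0 < q p S" "0 < q ?p' S" if "S \<subseteq> V" for S
    using reg p' that by (auto simp: positive_region_def)
  have MV: "M \<subseteq> V" "V - {i} \<subseteq> V" by (auto simp: M_def)
  define \<pi> where "\<pi> = q p (V - {i}) / q p M"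
  define \<pi>' where "\<pi>' = q ?p' (V - {i}) / q ?p' M"
  have \<pi>0: "0 < \<pi>" "0 < \<pi>'" using pos MV by (auto simp: \<pi>_def \<pi>'_def)
  have qV: "q p' V = q p' (V - {i}) - p' i * q p' M" for p'
    using q_insert[of "V - {i}" i p'] V L(3) unfolding M_def by (simp add: insert_absorb)
  have \<rho>: "\<rho> = 1 / (\<pi> - p i)"
    unfolding \<rho>_def M_def[symmetric] \<pi>_def qV[of p] using pos(1)[OF MV(1)] by (simp add: field_simps)
  have gt: "0 < \<pi> - p i"
    using qV[of p] pos(1)[OF MV(1)] pos(1)[OF order_refl] by (simp add: \<pi>_def field_simps)
  then show "0 < \<rho>" by (simp add: \<rho>)
  have "\<pi>' \<le> \<pi>"
  proof -
    have "V - {i} \<union> M = V - {i}" by (auto simp: M_def)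
    then show ?thesis
      unfolding \<pi>'_def \<pi>_def using q_ratio_antimono[OF V p', of p "V - {i}" M] p \<delta> MV
      by (simp add: distrib_right)
  qed
  moreover have "(1 + \<delta>) * p i < \<pi>'"
    using qV[of ?p'] pos(2)[OF MV(1)] pos(2)[OF order_refl] by (simp add: \<pi>'_def field_simps)
  ultimately have le: "\<delta> * p i \<le> \<pi> - p i" by (simp add: algebra_simps)
  then show "p i * \<rho> \<le> 1 / \<delta>" using gt \<delta> by (simp add: \<rho> field_simps)
  let ?N = "filter (adj i) L" and ?M = "filter (\<lambda>u. \<not> adj i u) L"
  define Y where "Y = tree_ratio adj p (1 + h) ?N ?M w"
  have sets: "set ?N \<union> set ?M = V - {i}" "set ?M = M" using L by (auto simp: M_def)
  have w0: "0 < w" using w n1 \<delta> by (simp add: n_def)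
  have "distinct (?N @ ?M)" "set (?N @ ?M) \<subseteq> V" using L by auto
  from tree_ratio_bounds[OF V \<delta> h(1,3) p' p this w0, unfolded sets(1), unfolded sets(2), folded \<pi>_def Y_def]
  have Y: "\<pi> \<le> Y" "ln (Y / \<pi>) \<le> length ?N * ((1 + h) / (\<delta>\<^sup>2 * w))" by auto
  then show "0 < y" "1 / y \<le> \<rho>" using gt by (auto simp: y_def Y_def[symmetric] \<rho> frac_le)
  define E where "E = ln (Y / \<pi>)"
  have E0: "0 \<le> E" using Y \<pi>0 by (simp add: E_def)
  have "length ?N \<le> length L" by simp
  also have "length L = card (V - {i})" using distinct_card[OF L(1)] L(2) by simp
  also have "\<dots> \<le> card V" using V by (intro card_mono) auto
  finally have len: "length ?N \<le> n" by (simp add: n_def)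
  have "E \<le> n * (2 / (\<delta>\<^sup>2 * w))"
    unfolding E_def using Y(2) len n1 w0 \<delta> h
    by (elim order_trans) (intro mult_mono divide_right_mono, auto)
  \<comment> \<open>The value of \<open>w\<close> is made for this line. One factor \<delta> is lost
    to the cancellation in \<open>\<pi> - p i\<close>, the other gives the accuracy
    \<delta>/(2n).\<close>
  also have "\<dots> = \<delta>\<^sup>2 / (8 * n)"
    using n1 \<delta> by (simp add: w n_def[symmetric] field_simps power2_eq_square eval_nat_numeral)
  finally have E: "E \<le> \<delta>\<^sup>2 / (8 * n)" .
  also have "\<dots> \<le> 1 / 1" using n1 \<delta> by (intro frac_le) (auto simp: power_le_one)
  finally have E1: "E \<le> 1" by simp
  have "exp E \<le> 1 + E + E\<^sup>2" using exp_bound[OF E0 E1] .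
  moreover have "E\<^sup>2 \<le> E * 1" unfolding power2_eq_square using E0 E1 by (intro mult_left_mono) auto
  ultimately have "exp E - 1 \<le> 2 * E" by simp
  then have "(exp E - 1) * \<pi> \<le> 2 * E * \<pi>" using \<pi>0 by (intro mult_right_mono) auto
  moreover have "Y = exp E * \<pi>" using Y \<pi>0 by (simp add: E_def)
  ultimately have "Y - \<pi> \<le> 2 * E * \<pi>" by (simp add: algebra_simps)
  also have "\<dots> \<le> 2 * (\<delta>\<^sup>2 / (8 * n)) * \<pi>" using E \<pi>0 by (intro mult_right_mono mult_left_mono) auto
  also have "\<dots> = \<delta> / (4 * n) * (\<delta> * \<pi>)" by (simp add: power2_eq_square)
  also have "\<dots> \<le> \<delta> / (4 * n) * (2 * (\<pi> - p i))"
  proof (intro mult_left_mono)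
    have "\<delta> * (\<pi> - p i) \<le> 1 * (\<pi> - p i)" using \<delta> gt by (intro mult_right_mono) auto
    then show "\<delta> * \<pi> \<le> 2 * (\<pi> - p i)" using le by (simp add: algebra_simps)
  qed (use \<delta> n1 in auto)
  also have "\<dots> = \<delta> / (2 * n) * (\<pi> - p i)" using n1 by (simp add: field_simps)
  finally have "y \<le> (1 + \<delta> / (2 * n)) * (\<pi> - p i)"
    unfolding y_def Y_def[symmetric] by (simp add: algebra_simps)
  then show "\<rho> \<le> (1 + \<delta> / (2 * real (card V))) * (1 / y)"
    using \<open>0 < y\<close> gt unfolding n_def[symmetric] \<rho> by (simp add: field_simps)
qed

text \<open>At an endpoint \<open>r\<close> the value \<open>q r V\<close> is \<open>q p V\<close>
  times 1 minus the sum of \<open>(r i - p i) * \<rho> i\<close>. The endpoint with the smaller sum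
  over 1/y is chosen, so its sum over \<rho> exceeds that of the other endpoint by at most \<tau>
  times the latter. Weighted with the share of the other endpoint in the mixture \<open>p\<close>,
  the excess is at most \<tau> times the sum of \<open>p i * \<rho> i\<close>, hence below 1. The
  hypothesis is at scale \<open>1 + \<delta>\<close> and the conclusion at scale 1: this is the
  slack given up.\<close>

lemma conditional_choice:
  fixes L :: "'a \<Rightarrow> 'a list"
  assumes V: "finite V" and \<delta>: "0 < \<delta>" "\<delta> \<le> 1" and h: "0 \<le> h" "h \<le> 1" "h\<^sup>2 \<le> 2 * \<delta>"
    and p': "(\<lambda>v. (1 + \<delta>) * p v) \<in> positive_region adj V"
    and L: "\<And>i. i \<in> V \<Longrightarrow> distinct (L i) \<and> set (L i) = V - {i}"
    and w: "w = 16 * (real (card V))\<^sup>2 / \<delta> ^ 4"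
    and C: "\<And>i j. i \<in> C \<Longrightarrow> j \<in> C \<Longrightarrow> i \<noteq> j \<Longrightarrow> adj i j"
    and z: "0 \<le> z" "z \<le> 1"
    and mix: "\<And>v. v \<in> V \<Longrightarrow> p v = z * p1 v + (1 - z) * p0 v"
    and off: "\<And>v. v \<in> V - C \<Longrightarrow> p1 v = p0 v"
    and nonneg: "\<And>v. v \<in> V \<Longrightarrow> 0 \<le> p0 v" "\<And>v. v \<in> V \<Longrightarrow> 0 \<le> p1 v"
  defines "y \<equiv> \<lambda>i. tree_ratio adj p (1 + h) (filter (adj i) (L i)) (filter (\<lambda>u. \<not> adj i u) (L i)) w - p i"
  shows "(if 0 < (\<Sum>i\<in>V. (p1 i - p0 i) / y i) then p0 else p1) \<in> positive_region adj V"
proof -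
  have p: "0 \<le> p v" if "v \<in> V" for v using that mix nonneg z by simp
  define \<rho> where "\<rho> i = q p {v \<in> V - {i}. \<not> adj i v} / q p V" for i
  define \<tau> where "\<tau> = \<delta> / (2 * real (card V))"
  have bounds: "0 < \<rho> i" "0 < y i" "1 / y i \<le> \<rho> i" "\<rho> i \<le> (1 + \<tau>) * (1 / y i)" "p i * \<rho> i \<le> 1 / \<delta>"
    if "i \<in> V" for i
    using vertex_weight_bounds[OF V \<delta> h p' p, of "L i" i w] L[OF that] that w
    by (simp_all add: \<rho>_def y_def \<tau>_def)
  have reg: "p \<in> positive_region adj V"
    using \<delta> p by (intro positive_region_antimono[OF V p']) (auto simp: distrib_right)
  then have qV: "0 < q p V" by (auto simp: positive_region_def)
  have \<tau>0: "0 \<le> \<tau>" using \<delta> by (simp add: \<tau>_def)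
  \<comment> \<open>At most \<open>card V\<close> terms of size at most 1/\<delta>; the bound is in
    fact 1/2, which calibrates \<tau>.\<close>
  have A: "\<tau> * (\<Sum>i\<in>V \<inter> C. p i * \<rho> i) < 1"
  proof (cases "V = {}")
    case False
    have "(\<Sum>i\<in>V \<inter> C. p i * \<rho> i) \<le> real (card (V \<inter> C)) * (1 / \<delta>)"
      using bounds by (intro sum_bounded_above) auto
    also have "\<dots> \<le> real (card V) * (1 / \<delta>)"
      using \<delta> V by (intro mult_right_mono) (auto intro: card_mono)
    finally have "\<tau> * (\<Sum>i\<in>V \<inter> C. p i * \<rho> i) \<le> \<tau> * (real (card V) * (1 / \<delta>))"
      using \<tau>0 by (intro mult_left_mono)
    also have "\<dots> = 1 / 2" using \<delta> False V by (simp add: \<tau>_def)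
    finally show ?thesis by simp
  qed simp
  have move: "q r V = q p V * (1 - (\<Sum>i\<in>V \<inter> C. (r i - p i) * \<rho> i))"
    if "\<And>v. v \<in> V - C \<Longrightarrow> r v = p v" for r
    using q_clique_affine[OF V C that] qV
    by (simp add: \<rho>_def right_diff_distrib sum_distrib_left)
  \<comment> \<open>Here \<open>a\<close> is the chosen and \<open>b\<close> the rejected endpoint.
    The two choices are symmetric, with \<open>s = z\<close> for \<open>p1\<close> and
    \<open>s = 1 - z\<close> for \<open>p0\<close>.\<close>
  have claim: "(\<Sum>i\<in>V \<inter> C. (a i - p i) * \<rho> i) < 1"
    if mix': "\<And>i. i \<in> V \<Longrightarrow> p i = s * a i + (1 - s) * b i" and s: "0 \<le> s" "s \<le> 1"
      and a: "\<And>i. i \<in> V \<Longrightarrow> 0 \<le> a i" and b: "\<And>i. i \<in> V \<Longrightarrow> 0 \<le> b i"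
      and le: "(\<Sum>i\<in>V \<inter> C. a i * (1 / y i)) \<le> (\<Sum>i\<in>V \<inter> C. b i * (1 / y i))" for a b s
  proof -
    have "(\<Sum>i\<in>V \<inter> C. a i * \<rho> i) \<le> (\<Sum>i\<in>V \<inter> C. a i * ((1 + \<tau>) * (1 / y i)))"
      using bounds(4) a by (intro sum_mono mult_left_mono) auto
    also have "\<dots> = (1 + \<tau>) * (\<Sum>i\<in>V \<inter> C. a i * (1 / y i))"
      by (simp add: sum_distrib_left mult_ac)
    also have "\<dots> \<le> (1 + \<tau>) * (\<Sum>i\<in>V \<inter> C. b i * (1 / y i))"
      using le \<tau>0 by (intro mult_left_mono) auto
    also have "\<dots> \<le> (1 + \<tau>) * (\<Sum>i\<in>V \<inter> C. b i * \<rho> i)"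
      using bounds(3) b \<tau>0 by (intro mult_left_mono sum_mono) auto
    finally have ab: "(\<Sum>i\<in>V \<inter> C. a i * \<rho> i) - (\<Sum>i\<in>V \<inter> C. b i * \<rho> i) \<le> \<tau> * (\<Sum>i\<in>V \<inter> C. b i * \<rho> i)"
      by (simp add: algebra_simps)
    have "(\<Sum>i\<in>V \<inter> C. (a i - p i) * \<rho> i) =
        (\<Sum>i\<in>V \<inter> C. (1 - s) * (a i * \<rho> i - b i * \<rho> i))"
    proof (intro sum.cong refl)
      fix i assume "i \<in> V \<inter> C"
      then have "a i - p i = (1 - s) * (a i - b i)" using mix'[of i] by (simp add: algebra_simps)
      then show "(a i - p i) * \<rho> i = (1 - s) * (a i * \<rho> i - b i * \<rho> i)"
        by (simp only: left_diff_distrib mult.assoc right_diff_distrib)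
    qed
    also have "\<dots> = (1 - s) * ((\<Sum>i\<in>V \<inter> C. a i * \<rho> i) - (\<Sum>i\<in>V \<inter> C. b i * \<rho> i))"
      by (simp add: sum_distrib_left[symmetric] sum_subtractf)
    also have "\<dots> \<le> (1 - s) * (\<tau> * (\<Sum>i\<in>V \<inter> C. b i * \<rho> i))"
      using ab s by (intro mult_left_mono) auto
    also have "\<dots> = \<tau> * (\<Sum>i\<in>V \<inter> C. (1 - s) * b i * \<rho> i)" by (simp add: sum_distrib_left mult_ac)
    also have "\<dots> \<le> \<tau> * (\<Sum>i\<in>V \<inter> C. p i * \<rho> i)"
      using s a bounds(1) mix' \<tau>0
      by (intro mult_left_mono sum_mono mult_right_mono) (auto intro: less_imp_le)
    finally show ?thesis using A by linarith
  qed
  have D: "(\<Sum>i\<in>V. (p1 i - p0 i) / y i) =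
      (\<Sum>i\<in>V \<inter> C. p1 i * (1 / y i)) - (\<Sum>i\<in>V \<inter> C. p0 i * (1 / y i))"
  proof -
    have "(\<Sum>i\<in>V. (p1 i - p0 i) / y i) = (\<Sum>i\<in>V \<inter> C. (p1 i - p0 i) / y i)"
      using V off by (intro sum.mono_neutral_right) auto
    then show ?thesis by (simp add: diff_divide_distrib sum_subtractf)
  qed
  have off': "p1 v = p v" "p0 v = p v" if "v \<in> V - C" for v
    using mix[of v] off[OF that] that by (auto simp: algebra_simps)
  have "(if 0 < (\<Sum>i\<in>V. (p1 i - p0 i) / y i) then p0 else p1) = r \<Longrightarrow> r \<in> positive_region adj V" for r
  proof (rule positive_region_clique_move[OF V C _ reg])
    assume r: "(if 0 < (\<Sum>i\<in>V. (p1 i - p0 i) / y i) then p0 else p1) = r"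
    show eq: "r v = p v" if "v \<in> V - C" for v using r off'[OF that] by (auto split: if_splits)
    show "0 \<le> r v" if "v \<in> V" for v using r nonneg that by auto
    have "(\<Sum>i\<in>V \<inter> C. (r i - p i) * \<rho> i) < 1"
    proof (cases "0 < (\<Sum>i\<in>V. (p1 i - p0 i) / y i)")
      case True
      then have "r = p0" using r by simp
      have "p i = (1 - z) * p0 i + (1 - (1 - z)) * p1 i" if "i \<in> V" for i using mix[OF that] by simp
      from claim[OF this] show ?thesis using True z nonneg unfolding D \<open>r = p0\<close> by simp
    next
      case False
      then show ?thesis
        using claim[OF mix z nonneg(2,1)] r unfolding D by simp
    qed
    then show "0 < q r V" using move[OF eq] qV by simp
  qed
  then show ?thesis by blast
qed

end

section \<open>Event probabilities\<close>

definition rest_dist :: "nat \<Rightarrow> (nat \<Rightarrow> real) \<Rightarrow> nat \<Rightarrow> (nat \<Rightarrow> bool) pmf" where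
  "rest_dist m z j = Pi_pmf ({..<m} - {j}) False (\<lambda>k. bernoulli_pmf (z k))"

lemma prod_dist_upd:
  assumes "j < m"
  shows "prod_dist m (z(j := c)) =
    bernoulli_pmf c \<bind> (\<lambda>b. map_pmf (\<lambda>f. f(j := b)) (rest_dist m z j))"
proof -
  let ?p = "\<lambda>k. bernoulli_pmf ((z(j := c)) k)"
  have rest: "Pi_pmf ({..<m} - {j}) False ?p = rest_dist m z j"
    unfolding rest_dist_def by (intro Pi_pmf_cong) auto
  have "prod_dist m (z(j := c)) = Pi_pmf (insert j ({..<m} - {j})) False ?p"
    using assms unfolding prod_dist_def by (intro Pi_pmf_cong) auto
  also have "\<dots> = ?p j \<bind> (\<lambda>b. Pi_pmf ({..<m} - {j}) False ?p \<bind> (\<lambda>f. return_pmf (f(j := b))))"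
    by (rule Pi_pmf_insert') auto
  finally show ?thesis unfolding rest by (simp add: map_pmf_def)
qed

lemma event_prob_upd:
  assumes "j < m" "0 \<le> c" "c \<le> 1"
  shows "event_prob m E (z(j := c)) i =
    c * measure_pmf.prob (rest_dist m z j) {f. f(j := True) \<in> E i} +
    (1 - c) * measure_pmf.prob (rest_dist m z j) {f. f(j := False) \<in> E i}"
    (is "_ = c * ?t + (1 - c) * ?f")
proof -
  have "emeasure (measure_pmf (prod_dist m (z(j := c)))) (E i) = ennreal (c * ?t + (1 - c) * ?f)"
    unfolding prod_dist_upd[OF assms(1)] emeasure_bind_pmf using assms(2,3)
    by (simp add: vimage_def measure_pmf.emeasure_eq_measure ennreal_mult mult.commute)
  then show ?thesis using assms(2,3)
    unfolding event_prob_def by (intro measure_eq_emeasure_eq_ennreal) auto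
qed

lemma event_prob_mix:
  assumes "j < m" "0 \<le> z j" "z j \<le> 1"
  shows "event_prob m E z i = z j * event_prob m E (z(j := 1)) i + (1 - z j) * event_prob m E (z(j := 0)) i"
  using event_prob_upd[of j m "z j" E z i] event_prob_upd[of j m 1 E z i] event_prob_upd[of j m 0 E z i]
    assms by simp

lemma event_prob_upd_irrelevant:
  assumes "j < m" "depends_only_on m (E i) (A i)" "j \<notin> A i"
  shows "event_prob m E (z(j := 1)) i = event_prob m E (z(j := 0)) i"
proof -
  have "{f. f(j := True) \<in> E i} \<inter> set_pmf (rest_dist m z j) =
      {f. f(j := False) \<in> E i} \<inter> set_pmf (rest_dist m z j)"
  proof -
    \<comment> \<open>The restriction to the support puts both updated functions into the cube,
      which is where \<open>depends_only_on\<close> makes its promise.\<close>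
    have "f(j := True) \<in> E i \<longleftrightarrow> f(j := False) \<in> E i" if "f \<in> set_pmf (rest_dist m z j)" for f
    proof -
      have "f k \<Longrightarrow> k < m" for k
        using that by (auto simp: rest_dist_def set_Pi_pmf PiE_dflt_def)
      then have "f(j := True) \<in> cube m" "f(j := False) \<in> cube m" using assms(1) by (auto simp: cube_def)
      moreover have "\<forall>k\<in>A i. (f(j := True)) k = (f(j := False)) k" using assms(3) by auto
      ultimately show ?thesis using assms(2) unfolding depends_only_on_def by blast
    qed
    then show ?thesis by blast
  qed
  then have "measure_pmf.prob (rest_dist m z j) {f. f(j := True) \<in> E i} =
      measure_pmf.prob (rest_dist m z j) {f. f(j := False) \<in> E i}"
    by (metis measure_Int_set_pmf)
  then show ?thesis using event_prob_upd[of j m 1 E z i] event_prob_upd[of j m 0 E z i] assms(1) by simp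
qed

lemma event_prob_point:
  assumes "\<omega> \<in> cube m" "\<And>j. j < m \<Longrightarrow> z j = of_bool (\<omega> j)"
  shows "event_prob m E z i = of_bool (\<omega> \<in> E i)"
proof -
  have "bernoulli_pmf (of_bool b) = return_pmf b" for b
    by (intro pmf_eqI) (case_tac i; cases b; simp)
  then have "prod_dist m z = Pi_pmf {..<m} False (\<lambda>j. return_pmf (\<omega> j))"
    unfolding prod_dist_def using assms(2) by (intro Pi_pmf_cong) auto
  also have "\<dots> = return_pmf \<omega>" using assms(1) by (auto simp: cube_def fun_eq_iff)
  finally show ?thesis by (simp add: event_prob_def indicator_def)
qed

lemma event_prob_nonneg: "0 \<le> event_prob m E z i"
  by (simp add: event_prob_def)

section \<open>Programs\<close>

text \<open>An upper bound instead of the exact count of \<open>eval\<close>, so that costs can be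
  weakened and combined by \<open>max\<close> over branches.\<close>

definition eval_within :: "exp list \<Rightarrow> val list \<Rightarrow> exp \<Rightarrow> nat \<Rightarrow> val \<Rightarrow> bool" where
  "eval_within Fs \<rho> e T v \<longleftrightarrow> (\<exists>t\<le>T. eval Fs \<rho> e t v)"

definition call_within :: "exp list \<Rightarrow> nat \<Rightarrow> val \<Rightarrow> nat \<Rightarrow> val \<Rightarrow> bool" where
  "call_within Fs k a T v \<longleftrightarrow> k < length Fs \<and> eval_within Fs [a] (Fs ! k) T v"

lemma eval_within_mono:
  "eval_within Fs \<rho> e T v \<Longrightarrow> T \<le> T' \<Longrightarrow> v = v' \<Longrightarrow> eval_within Fs \<rho> e T' v'"
  unfolding eval_within_def using le_trans by blast

lemma eval_within_Var: "k < length \<rho> \<Longrightarrow> \<rho> ! k = v \<Longrightarrow> eval_within Fs \<rho> (Var k) 1 v"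
  unfolding eval_within_def using eval.Var by blast

lemma eval_within_Lit: "eval_within Fs \<rho> (Lit k) 1 (VNum (real k))"
  unfolding eval_within_def using eval.Lit by blast

lemma eval_within_NilE: "eval_within Fs \<rho> NilE 1 VNil"
  unfolding eval_within_def using eval.NilE by blast

lemma eval_within_Let:
  "eval_within Fs \<rho> e1 T1 v1 \<Longrightarrow> eval_within Fs (v1 # \<rho>) e2 T2 v \<Longrightarrow>
    eval_within Fs \<rho> (exp.Let e1 e2) (1 + T1 + T2) v"
  unfolding eval_within_def by (meson eval.Let add_mono order_refl)

lemma eval_within_Arith:
  "eval_within Fs \<rho> e1 T1 (VNum x) \<Longrightarrow> eval_within Fs \<rho> e2 T2 (VNum y) \<Longrightarrow>
    eval_within Fs \<rho> (Arith f e1 e2) (1 + T1 + T2) (VNum (arith f x y))"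
  unfolding eval_within_def by (meson eval.Arith add_mono order_refl)

lemma eval_within_ConsE:
  "eval_within Fs \<rho> e1 T1 v1 \<Longrightarrow> eval_within Fs \<rho> e2 T2 v2 \<Longrightarrow>
    eval_within Fs \<rho> (ConsE e1 e2) (1 + T1 + T2) (VCons v1 v2)"
  unfolding eval_within_def by (meson eval.ConsE add_mono order_refl)

text \<open>Separates the value of the scrutinee from the choice of the branch. Once the scrutinee
  has been executed, its shape selects one of the two rules below, so one resolution loop can run a
  whole program.\<close>

definition case_within :: "exp list \<Rightarrow> val list \<Rightarrow> val \<Rightarrow> exp \<Rightarrow> exp \<Rightarrow> nat \<Rightarrow> val \<Rightarrow> bool" where
  "case_within Fs \<rho> a e2 e3 T v \<longleftrightarrow>
    (case a of VNil \<Rightarrow> eval_within Fs \<rho> e2 T v | VCons h r \<Rightarrow> eval_within Fs (h # r # \<rho>) e3 T v | _ \<Rightarrow> False)"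

lemma case_within_Nil: "eval_within Fs \<rho> e2 T v \<Longrightarrow> case_within Fs \<rho> VNil e2 e3 T v"
  by (simp add: case_within_def)

lemma case_within_Cons: "eval_within Fs (h # r # \<rho>) e3 T v \<Longrightarrow> case_within Fs \<rho> (VCons h r) e2 e3 T v"
  by (simp add: case_within_def)

lemma eval_within_CaseList:
  assumes "eval_within Fs \<rho> e1 T1 a" "case_within Fs \<rho> a e2 e3 T2 v"
  shows "eval_within Fs \<rho> (CaseList e1 e2 e3) (1 + T1 + T2) v"
proof (cases a)
  case VNil
  then show ?thesis
    using assms unfolding eval_within_def case_within_def VNil val.case
    by (meson eval.CaseList_Nil add_mono order_refl)
next
  case (VCons h r)
  then show ?thesis
    using assms unfolding eval_within_def case_within_def VCons val.case
    by (meson eval.CaseList_Cons add_mono order_refl)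
qed (use assms in \<open>simp add: case_within_def\<close>)

lemma eval_within_Call:
  "eval_within Fs \<rho> e T a \<Longrightarrow> call_within Fs k a T' v \<Longrightarrow>
    eval_within Fs \<rho> (Call k e) (1 + T + T') v"
  unfolding eval_within_def call_within_def by (meson eval.Call add_mono order_refl)

lemma eval_within_IfLess_True:
  assumes "eval_within Fs \<rho> e1 T1 (VNum x)" "eval_within Fs \<rho> e2 T2 (VNum y)" "x < y"
    and "eval_within Fs \<rho> e3 T3 v"
  shows "eval_within Fs \<rho> (IfLess e1 e2 e3 e4) (1 + T1 + T2 + T3) v"
  using assms unfolding eval_within_def by (meson eval.IfLess_True add_mono order_refl)

lemma eval_within_IfLess_False:
  assumes "eval_within Fs \<rho> e1 T1 (VNum x)" "eval_within Fs \<rho> e2 T2 (VNum y)" "\<not> x < y"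
    and "eval_within Fs \<rho> e4 T4 v"
  shows "eval_within Fs \<rho> (IfLess e1 e2 e3 e4) (1 + T1 + T2 + T4) v"
  using assms unfolding eval_within_def by (meson eval.IfLess_False add_mono order_refl)

text \<open>For conditionals with a known bound on both branches. The one-sided rules above serve
  where the other branch has none: the descent below the truncation weight, the search beyond its
  result, the rejected side of a round.\<close>

lemma eval_within_IfLess:
  assumes "eval_within Fs \<rho> e1 T1 (VNum x)" "eval_within Fs \<rho> e2 T2 (VNum y)"
    and "eval_within Fs \<rho> e3 T3 v" "eval_within Fs \<rho> e4 T4 v'"
  shows "eval_within Fs \<rho> (IfLess e1 e2 e3 e4) (1 + T1 + T2 + max T3 T4) (if x < y then v else v')"
proof (cases "x < y")
  case True
  then show ?thesis
    by (auto intro!: eval_within_mono[OF eval_within_IfLess_True[OF assms(1,2) True assms(3)]])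
next
  case False
  then show ?thesis
    by (auto intro!: eval_within_mono[OF eval_within_IfLess_False[OF assms(1,2) False assms(4)]])
qed

lemmas eval_within_intros =
  eval_within_Var eval_within_Lit eval_within_NilE eval_within_Let eval_within_Arith
  eval_within_ConsE eval_within_CaseList eval_within_Call case_within_Nil case_within_Cons

text \<open>\<open>T\<close> and \<open>v\<close> stay schematic during execution and are compared
  with the intended bound and value at the end.\<close>

lemma call_withinI:
  assumes "Fs ! k = body" "k < length Fs" "eval_within Fs [a] body T v" "T \<le> T'" "v = v'"
  shows "call_within Fs k a T' v'"
  using assms eval_within_mono unfolding call_within_def by blast

lemma call_within_mono: "call_within Fs k a T v \<Longrightarrow> T \<le> T' \<Longrightarrow> v = v' \<Longrightarrow> call_within Fs k a T' v'"
  using eval_within_mono unfolding call_within_def by blast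

lemma vlist_simps [simp]:
  "vlist [] = VNil" "vlist (x # xs) = VCons x (vlist xs)"
  "vreals [] = VNil" "vreals (y # ys) = VCons (VNum y) (vreals ys)"
  by (auto simp: vlist_def vreals_def)

section \<open>Data representation and program texts\<close>

definition vset :: "nat set \<Rightarrow> val" where
  "vset B = vreals (map real (sorted_list_of_set B))"

text \<open>Every vertex carries its probability and its set, so adjacency can be tested and lists
  filtered without looking up indices.\<close>

definition vertices :: "(nat \<Rightarrow> real) \<Rightarrow> (nat \<Rightarrow> nat set) \<Rightarrow> nat list \<Rightarrow> val" where
  "vertices p A S = vlist (map (\<lambda>i. VCons (VNum (p i)) (vset (A i))) S)"

lemma vertices_simps [simp]:
  "vertices p A [] = VNil"
  "vertices p A (i # S) = VCons (VCons (VNum (p i)) (vset (A i))) (vertices p A S)"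
  by (simp_all add: vertices_def)

text \<open>The functions of the given program come first, its main expression is function \<open>c\<close>, and the
  functions below are \<open>c + 1, \<dots>, c + 8\<close>. Every argument is a nested pair, which is
  unpacked at the start: unpacking \<open>(a\<^sub>1, \<dots>, a\<^sub>k)\<close> puts \<open>a\<^sub>k\<close> and \<open>a\<^bsub>k-1\<^esub>\<close> at the indices
  1 and 0, and \<open>a\<^sub>j\<close> for \<open>j < k - 1\<close> at \<open>2 (k - 1 - j)\<close>; the odd indices in between hold the pairs
  of the remaining components.\<close>

definition meets_body :: "nat \<Rightarrow> exp" where
  "meets_body c =
    CaseList (Var 0) NilE
      (CaseList (Var 0) (Lit 0)
        (CaseList (Var 3) (Lit 0)
          (IfLess (Var 2) (Var 0) (Call (c + 1) (ConsE (Var 3) (Var 5)))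
            (IfLess (Var 0) (Var 2) (Call (c + 1) (ConsE (Var 4) (Var 1)))
              (Lit 1)))))"

text \<open>Maps \<open>(A u, S)\<close> to the pair of the vertices of \<open>S\<close> whose sets
  meet \<open>A u\<close> and the remaining ones. \<open>NilE\<close> in the unpacking branches is a
  dummy that intended arguments never reach.\<close>

definition split_body :: "nat \<Rightarrow> exp" where
  "split_body c =
    CaseList (Var 0) NilE
      (CaseList (Var 1) (ConsE NilE NilE)
        (exp.Let (Call (c + 2) (ConsE (Var 2) (Var 1)))
          (CaseList (Var 0) NilE
            (CaseList (Var 3) NilE
              (IfLess (Lit 0) (Call (c + 1) (ConsE (Var 7) (Var 1)))
                (ConsE (ConsE (Var 5) (Var 2)) (Var 3))
                (ConsE (Var 2) (ConsE (Var 5) (Var 3))))))))"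

definition tree_body :: "nat \<Rightarrow> exp" where
  "tree_body c =
    CaseList (Var 0) NilE (CaseList (Var 1) NilE (CaseList (Var 1) NilE
      (CaseList (Var 4) (Lit 1)
        (Arith Mul
          (IfLess (Var 2) (Lit 1) (Lit 1)
            (CaseList (Var 0) NilE
              (exp.Let (Call (c + 2) (ConsE (Var 1) (Var 6)))
                (CaseList (Var 0) NilE
                  (Arith Sub (Lit 1) (Arith Div (Var 3)
                    (Call (c + 3) (ConsE (Var 0) (ConsE (Var 1)
                      (ConsE (Arith Div (Var 7) (Var 8)) (Var 8)))))))))))
          (Call (c + 3) (ConsE (Var 1) (ConsE (ConsE (Var 0) (Var 4)) (ConsE (Var 2) (Var 3)))))))))"

definition revapp_body :: "nat \<Rightarrow> exp" where
  "revapp_body c =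
    CaseList (Var 0) NilE
      (CaseList (Var 0) (Var 1)
        (Call (c + 4) (ConsE (Var 1) (ConsE (Var 0) (Var 3)))))"

text \<open>The argument \<open>(R, S, P1, P0, w, g)\<close> is a zipper: \<open>R\<close> holds the
  visited vertices in reverse, and reversing it onto the tail of \<open>S\<close> lists all vertices
  but the current one.\<close>

definition dsum_body :: "nat \<Rightarrow> exp" where
  "dsum_body c =
    CaseList (Var 0) NilE (CaseList (Var 1) NilE (CaseList (Var 1) NilE
     (CaseList (Var 1) NilE (CaseList (Var 1) NilE
      (CaseList (Var 6) (Lit 0)
       (CaseList (Var 6) NilE
        (CaseList (Var 6) NilE
         (CaseList (Var 4) NilE
          (exp.Let (Call (c + 2) (ConsE (Var 1) (Call (c + 4) (ConsE (Var 16) (Var 7)))))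
           (CaseList (Var 0) NilE
            (Arith Add
              (Arith Div (Arith Sub (Var 7) (Var 5))
                (Arith Sub (Call (c + 3) (ConsE (Var 0) (ConsE (Var 1) (Var 14)))) (Var 3)))
              (Call (c + 5) (ConsE (ConsE (Var 9) (Var 19))
                (ConsE (Var 10) (ConsE (Var 8) (ConsE (Var 6) (Var 14)))))))))))))))))"

definition vertices_body :: "nat \<Rightarrow> exp" where
  "vertices_body c =
    CaseList (Var 0) NilE (CaseList (Var 1) NilE
      (CaseList (Var 0) NilE
        (CaseList (Var 3) NilE
          (ConsE (ConsE (Arith Mul (Var 6) (Var 2)) (Var 0))
            (Call (c + 6) (ConsE (Var 6) (ConsE (Var 3) (Var 1))))))))"

text \<open>The argument is \<open>(R, zs, \<sigma>, x, As, 1 + \<delta>, w, g)\<close>, with the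
  rounded coordinates reversed in \<open>R\<close>, the others in \<open>zs\<close>, the scale
  \<sigma>, and \<open>(w, g)\<close> left packed. The three calls of function \<open>c\<close> give
  the probabilities at the current point and at both endpoints.\<close>

definition round_body :: "nat \<Rightarrow> exp" where
  "round_body c =
    CaseList (Var 0) NilE (CaseList (Var 1) NilE (CaseList (Var 1) NilE
     (CaseList (Var 1) NilE (CaseList (Var 1) NilE (CaseList (Var 1) NilE
      (CaseList (Var 8) (Call (c + 4) (ConsE (Var 10) NilE))
       (exp.Let (Arith Div (Var 8) (Var 2))
        (exp.Let (Call c (ConsE (Var 7) (ConsE (Call (c + 4) (ConsE (Var 13) (Var 11))) NilE)))
         (exp.Let (Call c (ConsE (Var 8)
             (ConsE (Call (c + 4) (ConsE (Var 14) (ConsE (Lit 1) (Var 3)))) NilE)))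
          (exp.Let (Call c (ConsE (Var 9)
              (ConsE (Call (c + 4) (ConsE (Var 15) (ConsE (Lit 0) (Var 4)))) NilE)))
           (IfLess (Lit 0)
             (Call (c + 5) (ConsE NilE
               (ConsE (Call (c + 6) (ConsE (Var 3) (ConsE (Var 2) (Var 8))))
                 (ConsE (Var 1) (ConsE (Var 0) (Var 7))))))
             (Call (c + 7) (ConsE (ConsE (Lit 0) (Var 16)) (ConsE (Var 5) (ConsE (Var 3) (Var 13)))))
             (Call (c + 7) (ConsE (ConsE (Lit 1) (Var 16)) (ConsE (Var 5) (ConsE (Var 3) (Var 13))))))))))))))))"

text \<open>Replaces the square root of m/\<alpha>: started at \<open>k = 1\<close>, it returns the
  first \<open>k\<close> whose square is at least m/\<alpha>.\<close>

definition search_body :: "nat \<Rightarrow> exp" where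
  "search_body c =
    CaseList (Var 0) NilE (CaseList (Var 1) NilE
      (IfLess (Arith Mul (Arith Mul (Var 2) (Var 2)) (Var 1)) (Var 0)
        (Call (c + 8) (ConsE (Arith Add (Var 2) (Lit 1)) (Var 3)))
        (Var 2)))"

definition main_body :: "nat \<Rightarrow> exp" where
  "main_body c =
    CaseList (Var 0) NilE (CaseList (Var 1) NilE (CaseList (Var 1) NilE
     (CaseList (Var 1) NilE (CaseList (Var 1) NilE (CaseList (Var 1) NilE
      (exp.Let (Arith Div (Var 0) (Arith Mul (Lit 2) (Var 8)))
       (exp.Let (Call (c + 8) (ConsE (Lit 1) (ConsE (Var 9) (Var 1))))
        (exp.Let (Arith Div (Arith Mul (Lit 16) (Arith Mul (Var 8) (Var 8)))
            (Arith Mul (Arith Mul (Var 1) (Var 1)) (Arith Mul (Var 1) (Var 1))))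
         (Call (c + 7) (ConsE NilE (ConsE (Var 5) (ConsE (Arith Add (Lit 1) (Var 3))
           (ConsE (Var 13) (ConsE (Var 7) (ConsE (Arith Add (Lit 1) (Var 2))
             (ConsE (Var 0) (Arith Add (Lit 1) (Arith Div (Lit 1) (Var 1)))))))))))))))))))"

section \<open>Correctness and cost of the list functions\<close>

locale rounding_program =
  fixes Fs :: "exp list" and c :: nat
  assumes length_Fs: "length Fs = c + 9"
    and bodies: "Fs ! (c + 1) = meets_body c" "Fs ! (c + 2) = split_body c" "Fs ! (c + 3) = tree_body c"
      "Fs ! (c + 4) = revapp_body c" "Fs ! (c + 5) = dsum_body c" "Fs ! (c + 6) = vertices_body c"
      "Fs ! (c + 7) = round_body c" "Fs ! (c + 8) = search_body c"
begin

lemma meets_within: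
  "sorted_wrt (<) xs \<Longrightarrow> sorted_wrt (<) ys \<Longrightarrow>
    call_within Fs (c + 1) (VCons (vreals xs) (vreals ys)) (16 * (length xs + length ys) + 16)
      (VNum (of_bool (set xs \<inter> set ys \<noteq> {})))"
proof (induction "length xs + length ys" arbitrary: xs ys rule: less_induct)
  case less
  note intros = call_withinI[OF bodies(1)[unfolded meets_body_def]]
  show ?case
  proof (cases xs)
    case Nil
    show ?thesis
      unfolding Nil vlist_simps
      by (rule intros, simp add: length_Fs, (rule eval_within_intros | (simp; fail))+)
  next
    case xs: (Cons x xs')
    show ?thesis
    proof (cases ys)
      case Nil
      show ?thesis
        unfolding xs Nil vlist_simps
        by (rule intros, simp add: length_Fs, (rule eval_within_intros | (simp; fail))+)
    next
      case ys: (Cons y ys')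
      have IH: "call_within Fs (c + 1) (VCons (vreals xs') (VCons (VNum y) (vreals ys')))
          (16 * (length xs' + length ys) + 16) (VNum (of_bool (set xs' \<inter> set ys \<noteq> {})))"
        "call_within Fs (c + 1) (VCons (VCons (VNum x) (vreals xs')) (vreals ys'))
          (16 * (length xs + length ys') + 16) (VNum (of_bool (set xs \<inter> set ys' \<noteq> {})))"
        using less.hyps[of xs' ys] less.hyps[of xs ys'] less.prems unfolding xs ys by auto
      show ?thesis
        unfolding xs ys vlist_simps
        by (rule intros, simp add: length_Fs, (rule eval_within_intros eval_within_IfLess IH | (simp; fail))+)
          (use less.prems in \<open>auto simp: xs ys\<close>)
    qed
  qed
qed

lemma meets_vset_within:
  assumes "B \<subseteq> {..<m}" "B' \<subseteq> {..<m}"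
  shows "call_within Fs (c + 1) (VCons (vset B) (vset B')) (32 * m + 16) (VNum (of_bool (B \<inter> B' \<noteq> {})))"
proof -
  have fin: "finite B" "finite B'" using assms finite_subset by blast+
  have "card B \<le> m" "card B' \<le> m" using assms card_mono[of "{..<m}"] by fastforce+
  moreover have "sorted_wrt (<) (map real (sorted_list_of_set B))" for B
    by (simp add: sorted_wrt_map)
  moreover have "real ` B \<inter> real ` B' = {} \<longleftrightarrow> B \<inter> B' = {}" by auto
  ultimately show ?thesis
    unfolding vset_def using fin
    by (intro call_within_mono[OF meets_within]) auto
qed

lemma split_within:
  assumes A: "\<And>i. i \<in> insert u (set S) \<Longrightarrow> A i \<subseteq> {..<m}" and "u \<notin> set S"
  shows "call_within Fs (c + 2) (VCons (vset (A u)) (vertices p A S)) ((length S + 1) * (32 * m + 60))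
    (VCons (vertices p A (filter (dep_adj A u) S)) (vertices p A (filter (\<lambda>v. \<not> dep_adj A u v) S)))"
  using assms
proof (induction S)
  case Nil
  note intros = call_withinI[OF bodies(2)[unfolded split_body_def]]
  show ?case
    unfolding vertices_simps
    by (rule intros, simp add: length_Fs, (rule eval_within_intros | (simp; fail))+)
next
  case (Cons v S)
  note intros = call_withinI[OF bodies(2)[unfolded split_body_def]]
  have IH: "call_within Fs (c + 2) (VCons (vset (A u)) (vertices p A S)) ((length S + 1) * (32 * m + 60))
    (VCons (vertices p A (filter (dep_adj A u) S)) (vertices p A (filter (\<lambda>v. \<not> dep_adj A u v) S)))"
    using Cons.prems by (intro Cons.IH) auto
  have meets: "call_within Fs (c + 1) (VCons (vset (A u)) (vset (A v))) (32 * m + 16)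
      (VNum (of_bool (A u \<inter> A v \<noteq> {})))"
    using Cons.prems by (intro meets_vset_within) auto
  show ?case
    unfolding vertices_simps
    by (rule intros, simp add: length_Fs, (rule eval_within_intros eval_within_IfLess IH meets | (simp; fail))+)
      (use Cons.prems in \<open>auto simp: dep_adj_def[of A u v]\<close>)
qed

lemma revapp_within:
  "call_within Fs (c + 4) (VCons (vlist xs) (vlist ys)) (12 * length xs + 12) (vlist (rev xs @ ys))"
proof (induction xs arbitrary: ys)
  case Nil
  show ?case
    unfolding vlist_simps
    by (rule call_withinI[OF bodies(4)[unfolded revapp_body_def]], simp add: length_Fs,
      (rule eval_within_intros | (simp; fail))+)
next
  case (Cons x xs)
  have IH: "call_within Fs (c + 4) (VCons (vlist xs) (VCons x (vlist ys))) (12 * length xs + 12)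
    (vlist (rev (x # xs) @ ys))" using Cons.IH[of "x # ys"] by simp
  show ?case
    unfolding vlist_simps
    by (rule call_withinI[OF bodies(4)[unfolded revapp_body_def]], simp add: length_Fs,
      (rule eval_within_intros IH | (simp; fail))+)
qed

lemma search_within:
  assumes "\<And>k'. k' < K \<Longrightarrow> k \<le> k' \<Longrightarrow> real k' * real k' * \<alpha> < M" "\<not> real K * real K * \<alpha> < M" "k \<le> K"
  shows "call_within Fs (c + 8) (VCons (VNum (real k)) (VCons (VNum M) (VNum \<alpha>))) (24 * (K - k) + 24)
    (VNum (real K))"
  using assms
proof (induction "K - k" arbitrary: k)
  case 0
  then have "k = K" by simp
  then show ?case
    by (intro call_withinI[OF bodies(8)[unfolded search_body_def]], simp add: length_Fs)
      (rule eval_within_intros eval_within_IfLess_False | use 0 in \<open>simp; fail\<close>)+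
next
  case (Suc j)
  have lt: "real k * real k * \<alpha> < M" using Suc.prems(1)[of k] Suc.hyps(2) by simp
  have IH: "call_within Fs (c + 8) (VCons (VNum (arith Add (real k) (real 1))) (VCons (VNum M) (VNum \<alpha>)))
      (24 * (K - Suc k) + 24) (VNum (real K))"
    using Suc.hyps(1)[of "Suc k"] Suc.hyps(2) Suc.prems by (simp add: add.commute)
  show ?case
    by (rule call_withinI[OF bodies(8)[unfolded search_body_def]], simp add: length_Fs)
      (rule eval_within_intros eval_within_IfLess_True IH | use Suc.hyps(2) lt in \<open>simp; fail\<close>)+
qed

lemma vertices_within:
  "call_within Fs (c + 6) (VCons (VNum \<sigma>) (VCons (vreals (map p S)) (vlist (map (\<lambda>i. vset (A i)) S))))
    (24 * length S + 24) (vertices (\<lambda>i. \<sigma> * p i) A S)"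
proof (induction S)
  case Nil
  show ?case
    unfolding list.map vlist_simps vertices_simps
    by (rule call_withinI[OF bodies(6)[unfolded vertices_body_def]], simp add: length_Fs)
      (rule eval_within_intros | (simp; fail))+
next
  case (Cons i S)
  show ?case
    unfolding list.map vlist_simps vertices_simps
    by (rule call_withinI[OF bodies(6)[unfolded vertices_body_def]], simp add: length_Fs)
      (rule eval_within_intros Cons.IH | (simp; fail))+
qed

end

section \<open>Cost of the tree recursion and of the derivative\<close>

text \<open>A closed form satisfying \<open>a + D * U l \<le> U (Suc l)\<close>, the recurrence for the cost per vertex
  with overhead \<open>a\<close> and branching \<open>D\<close>.\<close>

definition tree_cost :: "nat \<Rightarrow> nat \<Rightarrow> nat \<Rightarrow> nat" where
  "tree_cost a D l = a * (2 * D ^ l - 1)"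

lemma tree_cost_ge: "2 \<le> D \<Longrightarrow> a \<le> tree_cost a D l"
proof -
  assume "2 \<le> D"
  then have "1 \<le> 2 * D ^ l - 1" using one_le_power[of D l] by linarith
  from mult_le_mono2[OF this, of a] show ?thesis by (simp add: tree_cost_def)
qed

lemma tree_cost_Suc:
  assumes "2 \<le> D"
  shows "a + D * tree_cost a D l \<le> tree_cost a D (Suc l)"
proof -
  obtain y where y: "D ^ l = Suc y" using one_le_power[of D l] assms by (cases "D ^ l") auto
  have "1 + D * (2 * D ^ l - 1) \<le> 2 * D ^ Suc l - 1"
    using assms unfolding power_Suc y by (simp add: algebra_simps)
  from mult_left_mono[OF this, of a] show ?thesis
    by (simp add: tree_cost_def algebra_simps)
qed

text \<open>\<open>D\<close> bounds the degrees and is at least 2, which is exactly what the closed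
  form \<open>tree_cost\<close> needs to satisfy its recurrence.\<close>

locale rounding_instance = rounding_program +
  fixes m n D :: nat and A :: "nat \<Rightarrow> nat set"
  assumes A: "\<And>i. i < n \<Longrightarrow> A i \<subseteq> {..<m}"
    and D: "2 \<le> D" "\<And>i. i < n \<Longrightarrow> card {j. j < n \<and> dep_adj A i j} \<le> D"
begin

text \<open>The first summand is the cost of splitting at most \<open>n\<close> vertices, the second
  covers the remaining work for one vertex outside the recursive calls.\<close>

definition overhead :: nat where
  "overhead = (n + 1) * (32 * m + 60) + 100"

lemma length_neighbours_le:
  assumes "distinct M" "set M \<subseteq> {..<n}" "v < n"
  shows "length (filter (dep_adj A v) M) \<le> D"
proof -
  have "length (filter (dep_adj A v) M) = card (set (filter (dep_adj A v) M))"
    using assms by (intro distinct_card[symmetric]) auto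
  also have "\<dots> \<le> card {j. j < n \<and> dep_adj A v j}" using assms by (intro card_mono) auto
  finally show ?thesis using D(2)[OF assms(3)] by simp
qed

lemma length_le_n: "distinct M \<Longrightarrow> set M \<subseteq> {..<n} \<Longrightarrow> length M \<le> n"
  using card_mono[of "{..<n}" "set M"] by (simp add: distinct_card)

text \<open>Each vertex of \<open>N\<close> is charged \<open>tree_cost overhead D l\<close>. This
  covers its split and its descent to at most \<open>D\<close> neighbours at level
  \<open>l - 1\<close>, while the telescoping call stays at level \<open>l\<close> with one vertex
  less.\<close>

lemma tree_within:
  assumes g: "1 \<le> g"
  shows "distinct (N @ M) \<Longrightarrow> set (N @ M) \<subseteq> {..<n} \<Longrightarrow> w < g ^ l \<Longrightarrow>
    call_within Fs (c + 3) (VCons (vertices p A N) (VCons (vertices p A M) (VCons (VNum w) (VNum g))))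
      (length N * tree_cost overhead D l + 10) (VNum (tree_ratio (dep_adj A) p g N M w))"
proof (induction N M w arbitrary: l rule: tree_ratio_induct[where g = g and adj = "dep_adj A"])
  case (Nil M w)
  show ?case
    unfolding vertices_simps
    by (rule call_withinI[OF bodies(3)[unfolded tree_body_def]], simp add: length_Fs)
      (rule eval_within_intros | (simp; fail))+
next
  case (Cons v N M w)
  have v: "v < n" "v \<notin> set M" "distinct M" "set M \<subseteq> {..<n}" using Cons.prems by auto
  have IH2: "call_within Fs (c + 3)
      (VCons (vertices p A N) (VCons (VCons (VCons (VNum (p v)) (vset (A v))) (vertices p A M)) (VCons (VNum w) (VNum g))))
      (length N * tree_cost overhead D l + 10) (VNum (tree_ratio (dep_adj A) p g N (v # M) w))"
    using Cons.IH(2)[of l] Cons.prems by auto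
  show ?case
  proof (cases "w < 1")
    case True
    show ?thesis
      unfolding vertices_simps
      by (rule call_withinI[OF bodies(3)[unfolded tree_body_def]], simp add: length_Fs,
        (rule eval_within_intros eval_within_IfLess_True IH2 | use True in \<open>simp; fail\<close>)+)
        (use True tree_cost_ge[OF D(1), of overhead l] in \<open>simp_all add: overhead_def\<close>)
  next
    case False
    \<comment> \<open>\<open>w \<ge> 1\<close> excludes \<open>l = 0\<close>, so a level is left to
      pay for the descent.\<close>
    then obtain l' where l: "l = Suc l'" using Cons.prems(3) by (cases l) auto
    let ?N = "filter (dep_adj A v) M" and ?M = "filter (\<lambda>u. \<not> dep_adj A v u) M"
    have part: "call_within Fs (c + 2) (VCons (vset (A v)) (vertices p A M)) ((length M + 1) * (32 * m + 60))
        (VCons (vertices p A ?N) (vertices p A ?M))"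
      using v A by (intro split_within) auto
    have "w / g < g ^ l'" using Cons.prems(3) g unfolding l by (simp add: field_simps)
    then have IH1: "call_within Fs (c + 3)
        (VCons (vertices p A ?N) (VCons (vertices p A ?M) (VCons (VNum (arith Div w g)) (VNum g))))
        (length ?N * tree_cost overhead D l' + 10) (VNum (tree_ratio (dep_adj A) p g ?N ?M (w / g)))"
      using Cons.IH(1)[OF False, of l'] v by auto
    have "(length M + 1) * (32 * m + 60) \<le> (n + 1) * (32 * m + 60)"
      using length_le_n[OF v(3,4)] by (intro mult_right_mono) auto
    moreover have "length ?N * tree_cost overhead D l' \<le> D * tree_cost overhead D l'"
      using length_neighbours_le[OF v(3,4,1)] by (rule mult_right_mono) simp
    ultimately have cost: "(length M + 1) * (32 * m + 60) + length ?N * tree_cost overhead D l' + 100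
        \<le> tree_cost overhead D l"
      using tree_cost_Suc[OF D(1), of overhead l'] overhead_def unfolding l by linarith
    show ?thesis
      unfolding vertices_simps
      by (rule call_withinI[OF bodies(3)[unfolded tree_body_def]], simp add: length_Fs,
        (rule eval_within_intros eval_within_IfLess_False IH1 IH2 part | use False in \<open>simp; fail\<close>)+)
        (use False cost in \<open>simp_all\<close>)
  qed
qed

definition others :: "nat \<Rightarrow> nat list" where
  "others i = [0..<i] @ [Suc i..<n]"

text \<open>The \<open>y\<close> of \<open>conditional_choice\<close> for the enumeration
  \<open>others i\<close>, whose order is the one in which the program rebuilds the list from its
  zipper.\<close>

definition vertex_weight :: "(nat \<Rightarrow> real) \<Rightarrow> real \<Rightarrow> real \<Rightarrow> nat \<Rightarrow> real" where
  "vertex_weight p g w i = tree_ratio (dep_adj A) p g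
     (filter (dep_adj A i) (others i)) (filter (\<lambda>u. \<not> dep_adj A i u) (others i)) w - p i"

lemma others: "i < n \<Longrightarrow> distinct (others i) \<and> set (others i) = {..<n} - {i}"
  by (auto simp: others_def)

lemma dsum_within:
  assumes g: "1 \<le> g" and w: "w < g ^ l"
  shows "j \<le> n \<Longrightarrow> call_within Fs (c + 5)
    (VCons (vertices p A (rev [0..<j])) (VCons (vertices p A [j..<n])
      (VCons (vreals (map P1 [j..<n])) (VCons (vreals (map P0 [j..<n])) (VCons (VNum w) (VNum g))))))
    ((n - j) * (n * tree_cost overhead D l + overhead + 12 * n + 100) + 20)
    (VNum (\<Sum>i\<in>{j..<n}. (P1 i - P0 i) / vertex_weight p g w i))"
proof (induction "n - j" arbitrary: j)
  case 0
  then have "j = n" by simp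
  show ?case
    unfolding \<open>j = n\<close> upt_rec[of n n] if_not_P[OF less_irrefl] list.map vertices_simps vlist_simps
    by (rule call_withinI[OF bodies(5)[unfolded dsum_body_def]], simp add: length_Fs)
      (rule eval_within_intros | (simp; fail))+
next
  case (Suc k)
  then have j: "j < n" by simp
  have IH: "call_within Fs (c + 5)
    (VCons (VCons (VCons (VNum (p j)) (vset (A j))) (vertices p A (rev [0..<j]))) (VCons (vertices p A [Suc j..<n])
      (VCons (vreals (map P1 [Suc j..<n])) (VCons (vreals (map P0 [Suc j..<n])) (VCons (VNum w) (VNum g))))))
    ((n - Suc j) * (n * tree_cost overhead D l + overhead + 12 * n + 100) + 20)
    (VNum (\<Sum>i\<in>{Suc j..<n}. (P1 i - P0 i) / vertex_weight p g w i))"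
    using Suc.hyps(1)[of "Suc j"] Suc.hyps(2) j by auto
  have rev: "call_within Fs (c + 4) (VCons (vertices p A (rev [0..<j])) (vertices p A [Suc j..<n]))
      (12 * n + 12) (vertices p A (others j))"
    unfolding vertices_def by (rule call_within_mono[OF revapp_within])
      (use j in \<open>auto simp: others_def rev_map\<close>)
  let ?N = "filter (dep_adj A j) (others j)" and ?M = "filter (\<lambda>u. \<not> dep_adj A j u) (others j)"
  have part: "call_within Fs (c + 2) (VCons (vset (A j)) (vertices p A (others j))) ((n + 1) * (32 * m + 60))
      (VCons (vertices p A ?N) (vertices p A ?M))"
    by (rule call_within_mono[OF split_within])
      (use others[OF j] j A length_le_n[of "others j"] in \<open>auto intro!: mult_right_mono\<close>)
  have "length ?N \<le> n" using others[OF j] by (intro length_le_n) auto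
  then have tree: "call_within Fs (c + 3)
      (VCons (vertices p A ?N) (VCons (vertices p A ?M) (VCons (VNum w) (VNum g))))
      (n * tree_cost overhead D l + 10) (VNum (tree_ratio (dep_adj A) p g ?N ?M w))"
    using others[OF j] by (intro call_within_mono[OF tree_within[OF g _ _ w]]) auto
  have sum: "(\<Sum>i\<in>{j..<n}. (P1 i - P0 i) / vertex_weight p g w i) =
      arith Add (arith Div (arith Sub (P1 j) (P0 j)) (arith Sub (tree_ratio (dep_adj A) p g ?N ?M w) (p j)))
        (\<Sum>i\<in>{Suc j..<n}. (P1 i - P0 i) / vertex_weight p g w i)"
    using j by (simp add: sum.atLeast_Suc_lessThan vertex_weight_def)
  have nj: "n - j = Suc (n - Suc j)" using j by simp
  have cost: "(n - j) * (n * tree_cost overhead D l + overhead + 12 * n + 100) + 20 =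
      (n * tree_cost overhead D l + overhead + 12 * n + 100) +
      ((n - Suc j) * (n * tree_cost overhead D l + overhead + 12 * n + 100) + 20)"
    unfolding nj by simp
  show ?case
    unfolding upt_conv_Cons[OF j] list.map vertices_simps vlist_simps sum
    by (rule call_withinI[OF bodies(5)[unfolded dsum_body_def]], simp add: length_Fs,
        (rule eval_within_intros IH rev part tree | (simp; fail))+)
      (use cost in \<open>simp_all add: overhead_def\<close>)
qed

end

section \<open>The rounding loop\<close>

lemma dep_graph: "simple_graph (dep_adj A)"
  by unfold_locales (auto simp: dep_adj_def)

text \<open>The given program keeps its call indices because its functions come first in the
  combined list.\<close>

lemma eval_append_functions: "eval Fs \<rho> e t v \<Longrightarrow> eval (Fs @ Gs) \<rho> e t v"
proof (induction rule: eval.induct)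
  case (Call k \<rho> e t1 a t2 v)
  then show ?case using eval.Call[of k "Fs @ Gs" \<rho> e t1 a t2 v] by (simp add: nth_append)
qed (blast intro: eval.intros)+

lemma vvec_upd:
  assumes "j < m"
  shows "vvec m (z(j := y)) = vreals (rev (rev (map z [0..<j])) @ y # map z [Suc j..<m])"
proof -
  have "[0..<m] = [0..<j] @ j # [Suc j..<m]"
    using assms by (metis le0 upt_add_eq_append upt_conv_Cons le_add_diff_inverse less_imp_le_nat)
  then show ?thesis by (simp add: vvec_def)
qed

locale rounding_run = rounding_instance +
  fixes E :: "nat \<Rightarrow> (nat \<Rightarrow> bool) set" and x :: val and B :: nat and \<delta> h w :: real and l :: nat
  assumes system: "event_system m n A E"
    and probs: "\<And>z. unit_vector m z \<Longrightarrow>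
      call_within Fs c (VCons x (VCons (vvec m z) VNil)) B (vvec n (event_prob m E z))"
    and \<delta>: "0 < \<delta>" "\<delta> \<le> 1" and h: "0 \<le> h" "h \<le> 1" "h\<^sup>2 \<le> 2 * \<delta>"
    and w: "w = 16 * (real n)\<^sup>2 / \<delta> ^ 4" and l: "w < (1 + h) ^ l"
begin

definition bias :: "real \<Rightarrow> (nat \<Rightarrow> real) \<Rightarrow> nat \<Rightarrow> real" where
  "bias s z j = (\<Sum>i\<in>{0..<n}. (event_prob m E (z(j := 1)) i - event_prob m E (z(j := 0)) i) /
     vertex_weight (\<lambda>i. s * event_prob m E z i) (1 + h) w i)"

lemma bias_choice:
  assumes z: "unit_vector m z" "j < m" and s: "0 < s"
    and reg: "(\<lambda>i. (1 + \<delta>) * s * event_prob m E z i) \<in> positive_region (dep_adj A) {..<n}"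
  shows "(\<lambda>i. s * event_prob m E (z(j := if 0 < bias s z j then 0 else 1)) i)
    \<in> positive_region (dep_adj A) {..<n}"
proof -
  interpret simple_graph "dep_adj A" by (rule dep_graph)
  let ?p = "\<lambda>i. s * event_prob m E z i"
  let ?hi = "\<lambda>i. s * event_prob m E (z(j := 1)) i" and ?lo = "\<lambda>i. s * event_prob m E (z(j := 0)) i"
  have zj: "0 \<le> z j" "z j \<le> 1" using z by (auto simp: unit_vector_def)
  have reg': "(\<lambda>i. (1 + \<delta>) * ?p i) \<in> positive_region (dep_adj A) {..<n}"
    using reg by (simp add: mult.assoc)
  have mix: "?p i = z j * ?hi i + (1 - z j) * ?lo i" for i
    by (subst event_prob_mix[where z = z, OF z(2) zj]) (simp add: algebra_simps)
  have off: "?hi i = ?lo i" if "i \<in> {..<n} - {i. j \<in> A i}" for i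
    using event_prob_upd_irrelevant[OF z(2), of E i A z] that system by (auto simp: event_system_def)
  have "(if 0 < (\<Sum>i\<in>{..<n}. (?hi i - ?lo i) / vertex_weight ?p (1 + h) w i) then ?lo else ?hi)
      \<in> positive_region (dep_adj A) {..<n}"
    unfolding vertex_weight_def
    by (rule conditional_choice[where C = "{i. j \<in> A i}", OF _ \<delta> h reg' _ _ _ zj mix off])
      (use w others s in \<open>auto simp: dep_adj_def event_prob_nonneg\<close>)
  \<comment> \<open>The program sums unscaled differences of probabilities; the common factor
    \<open>s > 0\<close> does not affect the sign.\<close>
  moreover have "(\<Sum>i\<in>{..<n}. (?hi i - ?lo i) / vertex_weight ?p (1 + h) w i) = s * bias s z j"
    by (simp add: bias_def sum_distrib_left lessThan_atLeast0 right_diff_distrib)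
  ultimately show ?thesis using s by (auto simp: zero_less_mult_iff split: if_splits)
qed

definition round_cost :: nat where
  "round_cost = 3 * B + 36 * m + 24 * n +
     n * (n * tree_cost overhead D l + overhead + 12 * n + 100) + 300"

text \<open>Invariant of the loop: the prefix is integral and the probabilities lie in the region at
  scale \<sigma>. Each remaining round divides the scale by \<open>1 + \<delta>\<close>.\<close>

lemma round_within:
  "j \<le> m \<Longrightarrow> unit_vector m z \<Longrightarrow> (\<And>k. k < j \<Longrightarrow> z k \<in> {0, 1}) \<Longrightarrow> 0 < \<sigma> \<Longrightarrow>
    (\<lambda>i. \<sigma> * event_prob m E z i) \<in> positive_region (dep_adj A) {..<n} \<Longrightarrow>
    \<exists>\<omega>\<in>cube m. (\<lambda>i. \<sigma> / (1 + \<delta>) ^ (m - j) * of_bool (\<omega> \<in> E i)) \<in> positive_region (dep_adj A) {..<n} \<and>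
      call_within Fs (c + 7) (VCons (vreals (rev (map z [0..<j]))) (VCons (vreals (map z [j..<m]))
        (VCons (VNum \<sigma>) (VCons x (VCons (vsets n A) (VCons (VNum (1 + \<delta>)) (VCons (VNum w) (VNum (1 + h)))))))))
        ((m - j) * round_cost + 12 * m + 40) (vpoint m \<omega>)"
proof (induction "m - j" arbitrary: j z \<sigma>)
  case 0
  then have "j = m" by simp
  define \<omega> where "\<omega> k \<longleftrightarrow> k < m \<and> z k = 1" for k
  have \<omega>: "\<omega> \<in> cube m" "\<And>k. k < m \<Longrightarrow> z k = of_bool (\<omega> k)"
    using "0.prems"(3) \<open>j = m\<close> by (auto simp: cube_def \<omega>_def)
  have rev: "call_within Fs (c + 4) (VCons (vreals (rev (map z [0..<m]))) VNil) (12 * m + 12) (vpoint m \<omega>)"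
  proof -
    have "vpoint m \<omega> = vreals (map z [0..<m])" 
      unfolding vpoint_def vvec_def by (intro arg_cong[of _ _ vreals] map_cong refl) (use \<omega>(2) in auto)
    then show ?thesis
      using revapp_within[of "map VNum (rev (map z [0..<m]))" "[]"] by (simp add: vreals_def rev_map[symmetric])
  qed
  have "call_within Fs (c + 7) (VCons (vreals (rev (map z [0..<m]))) (VCons VNil
        (VCons (VNum \<sigma>) (VCons x (VCons (vsets n A) (VCons (VNum (1 + \<delta>)) (VCons (VNum w) (VNum (1 + h)))))))))
        (12 * m + 40) (vpoint m \<omega>)"
    by (rule call_withinI[OF bodies(7)[unfolded round_body_def]], simp add: length_Fs)
      (rule eval_within_intros rev | (simp; fail))+
  moreover have "event_prob m E z i = of_bool (\<omega> \<in> E i)" for i by (rule event_prob_point[OF \<omega>])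
  ultimately show ?case using "0.prems"(5) \<omega>(1) \<open>j = m\<close> by (intro bexI[of _ \<omega>]) simp_all
next
  case (Suc k)
  then have j: "j < m" by simp
  \<comment> \<open>\<open>bias_choice\<close> asks for slack \<open>1 + \<delta>\<close> over the
    scale it delivers. Dividing before the choice turns membership at scale \<sigma> into this
    slack.\<close>
  let ?s = "\<sigma> / (1 + \<delta>)"
  define b :: nat where "b = (if 0 < bias ?s z j then 0 else 1)"
  define z' where "z' = z(j := real b)"
  have unit: "unit_vector m (z(j := y))" if "0 \<le> y" "y \<le> 1" for y
    using Suc.prems(2) that by (auto simp: unit_vector_def)
  have s: "0 < ?s" "(1 + \<delta>) * ?s = \<sigma>" using Suc.prems(4) \<delta> by auto
  have reg': "(\<lambda>i. ?s * event_prob m E z' i) \<in> positive_region (dep_adj A) {..<n}"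
    using bias_choice[OF Suc.prems(2) j s(1)] Suc.prems(5) unfolding s(2) z'_def b_def by (auto split: if_splits)
  have "\<exists>\<omega>\<in>cube m. (\<lambda>i. ?s / (1 + \<delta>) ^ (m - Suc j) * of_bool (\<omega> \<in> E i)) \<in> positive_region (dep_adj A) {..<n} \<and>
      call_within Fs (c + 7) (VCons (vreals (rev (map z' [0..<Suc j]))) (VCons (vreals (map z' [Suc j..<m]))
        (VCons (VNum ?s) (VCons x (VCons (vsets n A) (VCons (VNum (1 + \<delta>)) (VCons (VNum w) (VNum (1 + h)))))))))
        ((m - Suc j) * round_cost + 12 * m + 40) (vpoint m \<omega>)"
    using Suc.prems(3) j Suc.hyps(2) unit s(1) reg'
    by (intro Suc.hyps(1)) (auto simp: z'_def b_def less_Suc_eq)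
  then obtain \<omega> where \<omega>: "\<omega> \<in> cube m"
      "(\<lambda>i. ?s / (1 + \<delta>) ^ (m - Suc j) * of_bool (\<omega> \<in> E i)) \<in> positive_region (dep_adj A) {..<n}"
    and run: "call_within Fs (c + 7) (VCons (vreals (rev (map z' [0..<Suc j]))) (VCons (vreals (map z' [Suc j..<m]))
        (VCons (VNum ?s) (VCons x (VCons (vsets n A) (VCons (VNum (1 + \<delta>)) (VCons (VNum w) (VNum (1 + h)))))))))
        ((m - Suc j) * round_cost + 12 * m + 40) (vpoint m \<omega>)" by blast
  have maps: "rev (map z' [0..<Suc j]) = real b # rev (map z [0..<j])" "map z' [Suc j..<m] = map z [Suc j..<m]"
    by (auto simp: z'_def)
  have rev: "call_within Fs (c + 4) (VCons (vreals (rev (map z [0..<j]))) (VCons (VNum y) (vreals (map z [Suc j..<m]))))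
      (12 * m + 12) (vvec m (z(j := y)))" for y
    unfolding vvec_upd[OF j]
    using call_within_mono[OF revapp_within[of "map VNum (rev (map z [0..<j]))" "map VNum (y # map z [Suc j..<m])"]] j
    by (auto simp: vreals_def rev_map[symmetric])
  have probs': "call_within Fs c (VCons x (VCons (vvec m (z(j := y))) VNil)) B (vvec n (event_prob m E (z(j := y))))"
    if "0 \<le> y" "y \<le> 1" for y by (rule probs[OF unit[OF that]])
  have probs1: "call_within Fs c (VCons x (VCons (vvec m (z(j := real b))) VNil)) B
      (vvec n (event_prob m E (z(j := real b))))" if "b \<le> 1" for b
    by (rule probs') (use that in simp_all)
  note calls = rev[of "z j", unfolded fun_upd_triv] rev[of "real 1"] rev[of "real 0"]
    probs[OF Suc.prems(2)] probs1[of 1, OF order_refl] probs1[of 0, OF zero_le_one]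
  let ?p = "\<lambda>i. ?s * event_prob m E z i"
  have vs: "call_within Fs (c + 6) (VCons (VNum ?s) (VCons (vvec n (event_prob m E z)) (vsets n A)))
      (24 * n + 24) (vertices ?p A [0..<n])"
    using vertices_within[of ?s "event_prob m E z" "[0..<n]" A] by (simp add: vvec_def vsets_def vset_def)
  have ds: "call_within Fs (c + 5) (VCons VNil (VCons (vertices ?p A [0..<n])
      (VCons (vvec n (event_prob m E (z(j := 1)))) (VCons (vvec n (event_prob m E (z(j := 0)))) (VCons (VNum w) (VNum (1 + h)))))))
      (n * (n * tree_cost overhead D l + overhead + 12 * n + 100) + 20) (VNum (bias ?s z j))"
    using dsum_within[OF _ l, of 0 ?p "event_prob m E (z(j := 1))" "event_prob m E (z(j := 0))"] h
    by (simp add: vvec_def bias_def)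
  have mj: "m - j = Suc (m - Suc j)" using j by simp
  have cost: "(m - j) * round_cost = round_cost + (m - Suc j) * round_cost" unfolding mj by simp
  note intros = call_withinI[OF bodies(7)[unfolded round_body_def]]
  have "call_within Fs (c + 7) (VCons (vreals (rev (map z [0..<j]))) (VCons (vreals (map z [j..<m]))
        (VCons (VNum \<sigma>) (VCons x (VCons (vsets n A) (VCons (VNum (1 + \<delta>)) (VCons (VNum w) (VNum (1 + h)))))))))
        ((m - j) * round_cost + 12 * m + 40) (vpoint m \<omega>)"
  proof (cases "0 < bias ?s z j")
    case True
    then have "b = 0" by (simp add: b_def)
    show ?thesis
      unfolding upt_conv_Cons[OF j] list.map vlist_simps
      by (rule intros, simp add: length_Fs,
        (rule eval_within_intros eval_within_IfLess_True calls vs ds run[unfolded maps vlist_simps \<open>b = 0\<close>]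
        | use True in \<open>simp; fail\<close>)+)
        (use cost in \<open>simp_all add: round_cost_def\<close>)
  next
    case False
    then have "b = 1" by (simp add: b_def)
    show ?thesis
      unfolding upt_conv_Cons[OF j] list.map vlist_simps
      by (rule intros, simp add: length_Fs,
        (rule eval_within_intros eval_within_IfLess_False calls vs ds run[unfolded maps vlist_simps \<open>b = 1\<close>]
        | use False in \<open>simp; fail\<close>)+)
        (use cost in \<open>simp_all add: round_cost_def\<close>)
  qed
  moreover have "?s / (1 + \<delta>) ^ (m - Suc j) = \<sigma> / (1 + \<delta>) ^ (m - j)"
    unfolding mj by simp
  ultimately show ?case using \<omega> by auto
qed

end

section \<open>Running time\<close>

definition rounding_algorithm :: "program \<Rightarrow> program" where
  "rounding_algorithm Q = (let c = length (fst Q) in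
    (fst Q @ [snd Q, meets_body c, split_body c, tree_body c, revapp_body c, dsum_body c,
       vertices_body c, round_body c, search_body c], main_body c))"

lemma rounding_program_algorithm:
  "rounding_program (fst (rounding_algorithm Q)) (length (fst Q))"
  by unfold_locales (simp_all add: rounding_algorithm_def Let_def nth_append)

lemma call_within_oracle:
  assumes "runs Q a t v" "t \<le> B"
  shows "call_within (fst (rounding_algorithm Q)) (length (fst Q)) a B v"
proof -
  have "eval (fst (rounding_algorithm Q)) [a] (snd Q) t v"
    using assms(1) by (simp add: runs_def rounding_algorithm_def Let_def eval_append_functions)
  then show ?thesis
    using assms(2) unfolding call_within_def eval_within_def
    by (auto simp: rounding_algorithm_def Let_def nth_append)
qed

lemma (in rounding_run) main_within:
  assumes \<alpha>: "0 < \<alpha>" "\<alpha> \<le> 1" and m: "1 \<le> m" and \<delta>_eq: "\<delta> = \<alpha> / (2 * real m)"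
    and k: "1 \<le> k" "\<And>i. i < k \<Longrightarrow> 1 \<le> i \<Longrightarrow> real i * real i * \<alpha> < real m" "\<not> real k * real k * \<alpha> < real m"
    and h_eq: "h = 1 / real k"
    and z: "unit_vector m z"
    and reg: "(\<lambda>i. (1 + \<alpha>) * event_prob m E z i) \<in> positive_region (dep_adj A) {..<n}"
  shows "\<exists>\<omega>. eval_within Fs [instance_input x m n A z \<alpha>] (main_body c)
      (24 * k + m * round_cost + 12 * m + 200) (vpoint m \<omega>) \<and>
    \<omega> \<in> cube m \<and> \<omega> \<in> (\<Inter>i<n. cube m - E i)"
proof -
  obtain \<omega> where \<omega>: "\<omega> \<in> cube m"
      "(\<lambda>i. (1 + \<alpha>) / (1 + \<delta>) ^ m * of_bool (\<omega> \<in> E i)) \<in> positive_region (dep_adj A) {..<n}"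
    and run: "call_within Fs (c + 7) (VCons VNil (VCons (vvec m z)
        (VCons (VNum (1 + \<alpha>)) (VCons x (VCons (vsets n A) (VCons (VNum (1 + \<delta>)) (VCons (VNum w) (VNum (1 + h)))))))))
        (m * round_cost + 12 * m + 40) (vpoint m \<omega>)"
    using round_within[of 0 z "1 + \<alpha>"] z reg \<alpha> by (auto simp: vvec_def)
  have "\<omega> \<notin> E i" if "i < n" for i
  proof
    interpret simple_graph "dep_adj A" by (rule dep_graph)
    assume "\<omega> \<in> E i"
    \<comment> \<open>The singleton \<open>{i}\<close> suffices: its value is 1 minus the scaled
      indicator of \<open>E i\<close>, and \<delta> = \<alpha>/(2m) leaves the final scale at least
      1.\<close>
    have "0 < shearer_poly (dep_adj A) (\<lambda>i. (1 + \<alpha>) / (1 + \<delta>) ^ m * of_bool (\<omega> \<in> E i)) {i}"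
      using \<omega>(2) that by (auto simp: positive_region_def)
    then have "(1 + \<alpha>) / (1 + \<delta>) ^ m < 1"
      using q_insert[of "{}" i] \<open>\<omega> \<in> E i\<close> by (simp add: shearer_poly_empty)
    then have "1 + \<alpha> < (1 + \<delta>) ^ m" using \<delta> by (simp add: field_simps)
    also have "\<dots> \<le> exp \<delta> ^ m" using \<delta> exp_ge_add_one_self[of \<delta>] by (intro power_mono) auto
    also have "\<dots> = exp (\<alpha> / 2)" using m by (simp add: \<delta>_eq flip: exp_of_nat_mult)
    also have "\<dots> \<le> 1 + \<alpha> / 2 + (\<alpha> / 2)\<^sup>2" using \<alpha> by (intro exp_bound) auto
    also have "(\<alpha> / 2)\<^sup>2 \<le> (\<alpha> / 2) * 1" unfolding power2_eq_square using \<alpha> by (intro mult_left_mono) auto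
    finally show False by simp
  qed
  then have \<omega>': "\<omega> \<in> (\<Inter>i<n. cube m - E i)" using \<omega>(1) by auto
  have search: "call_within Fs (c + 8) (VCons (VNum (real 1)) (VCons (VNum (real m)) (VNum \<alpha>))) (24 * k + 24)
      (VNum (real k))"
    using search_within[of k 1 \<alpha> "real m"] k by (auto intro: call_within_mono)
  \<comment> \<open>Plain execution would leave nested \<open>arith\<close> terms. These facts give
    the parameters in the form in which \<open>search\<close> and \<open>run\<close> expect
    them.\<close>
  have e\<delta>: "eval_within Fs (VNum \<alpha> # \<rho>1 # \<rho>2 # \<rho>3 # \<rho>4 # \<rho>5 # \<rho>6 # \<rho>7 # VNum (real m) # \<rho>)
      (Arith Div (Var 0) (Arith Mul (Lit 2) (Var 8))) 10 (VNum \<delta>)" for \<rho>1 \<rho>2 \<rho>3 \<rho>4 \<rho>5 \<rho>6 \<rho>7 \<rho>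
    by (rule eval_within_mono) (rule eval_within_intros | simp add: \<delta>_eq; fail)+
  have ew: "eval_within Fs (VNum (real k) # VNum \<delta> # \<rho>1 # \<rho>2 # \<rho>3 # \<rho>4 # \<rho>5 # \<rho>6 # VNum (real n) # \<rho>)
      (Arith Div (Arith Mul (Lit 16) (Arith Mul (Var 8) (Var 8)))
        (Arith Mul (Arith Mul (Var 1) (Var 1)) (Arith Mul (Var 1) (Var 1)))) 30 (VNum w)"
    for \<rho>1 \<rho>2 \<rho>3 \<rho>4 \<rho>5 \<rho>6 \<rho>
    by (rule eval_within_mono)
      (rule eval_within_intros | simp add: w power2_eq_square power4_eq_xxxx; fail)+
  have eg: "eval_within Fs (\<rho>0 # VNum (real k) # \<rho>) (Arith Add (Lit 1) (Arith Div (Lit 1) (Var 1))) 10 (VNum (1 + h))"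
    for \<rho>0 \<rho>
    by (rule eval_within_mono) (rule eval_within_intros | simp add: h_eq; fail)+
  have e\<sigma>: "eval_within Fs (\<rho>0 # \<rho>1 # \<rho>2 # VNum \<alpha> # \<rho>) (Arith Add (Lit 1) (Var 3)) 10 (VNum (1 + \<alpha>))"
    for \<rho>0 \<rho>1 \<rho>2 \<rho>
    by (rule eval_within_mono) (rule eval_within_intros | simp; fail)+
  have ee: "eval_within Fs (\<rho>0 # \<rho>1 # VNum \<delta> # \<rho>) (Arith Add (Lit 1) (Var 2)) 10 (VNum (1 + \<delta>))"
    for \<rho>0 \<rho>1 \<rho>
    by (rule eval_within_mono) (rule eval_within_intros | simp; fail)+
  have "eval_within Fs [instance_input x m n A z \<alpha>] (main_body c)
      (24 * k + m * round_cost + 12 * m + 200) (vpoint m \<omega>)"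
    unfolding instance_input_def vlist_simps main_body_def
    by (rule eval_within_mono) (rule e\<delta> ew eg e\<sigma> ee eval_within_intros search run | simp; fail)+
  then show ?thesis using \<omega>(1) \<omega>' by blast
qed

section \<open>Numerical estimates for the running time\<close>

lemma poly_nat_le_monomial:
  fixes b :: "nat poly"
  assumes "1 \<le> m"
  shows "poly b m \<le> (\<Sum>i\<le>degree b. coeff b i) * m ^ degree b"
  unfolding poly_altdef sum_distrib_right
  using assms by (intro sum_mono mult_left_mono power_increasing) auto

lemma least_square_root_scale:
  fixes \<alpha> :: real
  assumes "0 < \<alpha>" "\<alpha> \<le> 1" "1 \<le> m"
  obtains k where "1 \<le> k" "\<And>i. i < k \<Longrightarrow> 1 \<le> i \<Longrightarrow> real i * real i * \<alpha> < real m"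
    "\<not> real k * real k * \<alpha> < real m" "real k \<le> 2 * sqrt (real m / \<alpha>)"
proof -
  define P where "P k \<longleftrightarrow> 1 \<le> k \<and> \<not> real k * real k * \<alpha> < real m" for k :: nat
  define s where "s = sqrt (real m / \<alpha>)"
  have s: "1 \<le> s" "s * s * \<alpha> = real m" using assms by (auto simp: s_def field_simps)
  obtain k0 :: nat where k0: "s \<le> real k0" using real_arch_simple by blast
  have "s * s * \<alpha> \<le> real k0 * real k0 * \<alpha>" using k0 s assms by (intro mult_right_mono mult_mono) auto
  then have "P k0" using k0 s by (auto simp: P_def)
  define k where "k = (LEAST k. P k)"
  have k: "P k" unfolding k_def using \<open>P k0\<close> by (rule LeastI)
  have min: "real i * real i * \<alpha> < real m" if "i < k" "1 \<le> i" for i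
    using not_less_Least[OF that(1)[unfolded k_def]] that(2) by (auto simp: P_def)
  have "real k \<le> 2 * s"
  proof (cases "k = 1")
    case False
    then have "real (k - 1) * real (k - 1) * \<alpha> < s * s * \<alpha>" using min[of "k - 1"] k s by (auto simp: P_def)
    then have "(real (k - 1))\<^sup>2 < s\<^sup>2" using assms(1) by (simp add: power2_eq_square)
    then have "real (k - 1) < s" using s(1) by (intro power_less_imp_less_base[of _ 2 s]) auto
    then show ?thesis using s by linarith
  qed (use s in auto)
  then show ?thesis using that[of k] k min by (auto simp: P_def s_def)
qed

text \<open>By Bernoulli, \<open>k\<close> levels of the recursion divide the weight by at least
  2.\<close>

lemma power_one_plus_inverse_ge:
  assumes "1 \<le> k"
  shows "2 ^ L \<le> (1 + 1 / real k) ^ (k * L)"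
proof -
  have "2 \<le> (1 + 1 / real k) ^ k" using Bernoulli_inequality[of "1 / real k" k] assms order_trans[of "-1" 0 "1 / real k"] by simp
  then show ?thesis unfolding power_mult by (intro power_mono) auto
qed

text \<open>The part of the exponent without \<open>ln X\<close> has to be absorbed into a power of
  \<open>X\<close>. For \<open>X \<ge> 2\<close> this works since \<open>ln X \<ge> 2 / 3\<close>,
  raising 18 to 27, and 45 = 27 + 18. For \<open>X < 2\<close> a power of \<open>X\<close> gives
  nothing, but then n = m = 1, \<open>D = 2\<close> and \<open>s \<le> 2\<close>, so the part is at
  most the constant 2^36.\<close>

lemma exponent_bound:
  fixes X s :: real and m n d :: nat
  assumes "1 \<le> m" "1 \<le> n" "0 < \<alpha>" "\<alpha> \<le> 1" and d: "d = max_degree {..<n} (dep_adj A)"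
  defines "X \<equiv> real n * real m / \<alpha>" and "s \<equiv> sqrt (real m / \<alpha>)" and "D \<equiv> real (max 2 d)"
  assumes l: "real l \<le> 18 * s * (1 + ln X)"
  shows "D ^ l \<le> 2 ^ 36 * X powr (45 * ln D * s)"
proof -
  have D: "2 \<le> D" by (simp add: D_def)
  then have lnD: "0 < ln D" by simp
  have nm: "1 \<le> real n * real m" using assms mult_mono[of 1 "real n" 1 "real m"] by simp
  have X1: "1 \<le> X" using nm assms by (simp add: X_def field_simps)
  have s0: "0 \<le> s" using assms(3) by (simp add: s_def)
  have "D ^ l = exp (real l * ln D)" using D by (simp add: exp_of_nat_mult)
  also have "\<dots> \<le> exp (18 * s * (1 + ln X) * ln D)" using l lnD by simp
  also have "\<dots> = exp (18 * s * ln D) * exp (18 * s * ln X * ln D)" by (simp add: exp_add[symmetric] algebra_simps)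
  also have "exp (18 * s * ln D) \<le> 2 ^ 36 * exp (27 * s * ln X * ln D)"
  proof (cases "2 \<le> X")
    case True
    then have "2 / 3 \<le> ln X" using ln2_ge_two_thirds ln_le_cancel_iff[of 2 X] by linarith
    then have "18 * s * ln D * 1 \<le> 18 * s * ln D * (3 / 2 * ln X)" using s0 lnD by (intro mult_left_mono) auto
    then have "exp (18 * s * ln D) \<le> 1 * exp (27 * s * ln X * ln D)" by (simp add: mult_ac)
    also have "\<dots> \<le> 2 ^ 36 * exp (27 * s * ln X * ln D)" by (intro mult_right_mono) auto
    finally show ?thesis .
  next
    case False
    then have lt: "real n * real m < 2 * \<alpha>" using assms by (simp add: X_def field_simps)
    then have "n * m < 2" using assms(4) by (simp flip: of_nat_mult)
    then have "n = 1" "m = 1" using assms(1,2) by (auto simp: less_2_cases_iff)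
    have "d = 0" unfolding d max_degree_def \<open>n = 1\<close> by (auto simp: lessThan_Suc dep_adj_def)
    then have "D = 2" by (simp add: D_def)
    have "s \<le> sqrt 4" using lt \<open>n = 1\<close> \<open>m = 1\<close> assms(3) unfolding s_def by (intro real_sqrt_le_mono) (simp add: field_simps)
    then have "18 * s * ln D \<le> 36 * ln 2" using \<open>D = 2\<close> by simp
    then have "exp (18 * s * ln D) \<le> exp (36 * ln 2)" by simp
    also have "exp (36 * ln (2::real)) = 2 ^ 36" using exp_of_nat_mult[of 36 "ln (2::real)"] by simp
    also have "(2::real) ^ 36 * 1 \<le> 2 ^ 36 * exp (27 * s * ln X * ln D)"
      using X1 s0 lnD by (intro mult_left_mono) auto
    finally show ?thesis by simp
  qed
  finally have "D ^ l \<le> 2 ^ 36 * (exp (27 * s * ln X * ln D) * exp (18 * s * ln X * ln D))"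
    by (simp add: mult.assoc)
  also have "exp (27 * s * ln X * ln D) * exp (18 * s * ln X * ln D) = X powr (45 * ln D * s)"
    using X1 by (simp add: powr_def exp_add[symmetric] algebra_simps)
  finally show ?thesis .
qed

text \<open>Substituting \<delta> gives w = 256 n^2 (m/\<alpha>)^4 \<le> 256 X^6, with binary
  logarithm 8 + 6 ln X / ln 2 \<le> 8 + 9 ln X; rounding up adds at most 1.\<close>

lemma depth_bound:
  fixes X \<alpha> :: real
  assumes "1 \<le> m" "1 \<le> n" "0 < \<alpha>" "\<alpha> \<le> 1"
    and w: "w = 16 * (real n)\<^sup>2 / (\<alpha> / (2 * real m)) ^ 4"
  obtains L where "w < 2 ^ L" "real L \<le> 9 * (1 + ln (real n * real m / \<alpha>))"
proof -
  define X where "X = real n * real m / \<alpha>"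
  have nm: "1 \<le> real n * real m" using assms mult_mono[of 1 "real n" 1 "real m"] by simp
  have X1: "1 \<le> X" using nm assms by (simp add: X_def field_simps)
  have "w = 256 * ((real n)\<^sup>2 * (real m / \<alpha>) ^ 4)" using assms by (simp add: w field_simps)
  also have "\<dots> \<le> 256 * (X\<^sup>2 * X ^ 4)"
    using assms by (intro mult_left_mono mult_mono power_mono) (auto simp: X_def field_simps mult_le_cancel_left1 mult_le_cancel_right1)
  finally have wX: "w \<le> 256 * X ^ 6" by (simp flip: power_add)
  have w0: "0 < w" using assms by (simp add: w)
  define L where "L = nat \<lfloor>log 2 (256 * X ^ 6)\<rfloor> + 1"
  have X6: "1 \<le> X ^ 6" using X1 by (rule one_le_power)
  then have log0: "0 \<le> log 2 (256 * X ^ 6)" by (subst zero_le_log_cancel_iff) auto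
  have "256 * X ^ 6 = 2 powr log 2 (256 * X ^ 6)" using X1 by simp
  also have "\<dots> < 2 powr real L" using log0 unfolding L_def by (intro powr_less_mono) linarith+
  finally have 1: "w < 2 ^ L" using wX by (simp add: powr_realpow)
  have "log 2 256 = (8 :: real)" using log_pow_cancel[of 2 8] by simp
  then have "log 2 (256 * X ^ 6) = 8 + 6 * (ln X / ln 2)"
    using X1 by (simp add: log_mult log_nat_power log_def[of 2 X])
  also have "ln X / ln 2 \<le> ln X / (2 / 3)" using X1 ln2_ge_two_thirds by (intro divide_left_mono) auto
  finally have "log 2 (256 * X ^ 6) \<le> 8 + 9 * ln X" by simp
  moreover have "real L \<le> log 2 (256 * X ^ 6) + 1" using log0 unfolding L_def by simp
  ultimately have "real L \<le> 9 * (1 + ln X)" by simp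
  with 1 show ?thesis using that by (simp add: X_def)
qed

lemma total_cost_bound:
  fixes X :: real and n m :: nat
  assumes "1 \<le> real n" "real n \<le> X" "1 \<le> real m" "real m \<le> X" "real k \<le> 2 * X" "real B \<le> C * X ^ e"
    "0 \<le> C" "1 \<le> Dl" "real tc \<le> 2 * ov * Dl" "ov = (real n + 1) * (32 * real m + 60) + 100"
    and R: "R = 3 * real B + 36 * real m + 24 * real n +
      real n * (real n * real tc + ov + 12 * real n + 100) + 300"
  shows "24 * real k + real m * R + 12 * real m + 200 \<le> (3 * C + 1600) * X ^ (6 + e) * Dl"
proof -
  have X1: "1 \<le> X" using assms by linarith
  have nX: "real n * 1 \<le> X * X" "real m * 1 \<le> X * X" "1 * 1 \<le> X * X" "real n * real m \<le> X * X"
    using assms X1 by (intro mult_mono; simp)+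
  have ov: "ov \<le> 284 * X ^ 2"
    unfolding assms(10) power2_eq_square using nX by (simp add: algebra_simps)
  have ov0: "0 \<le> ov" using assms by simp
  have tc: "real tc \<le> 568 * X ^ 2 * Dl"
  proof -
    have "ov * (2 * Dl) \<le> 284 * X ^ 2 * (2 * Dl)" using ov assms(8) by (intro mult_right_mono) auto
    then show ?thesis using assms(9) by (simp add: mult_ac)
  qed
  define Y where "Y = X ^ 4 * Dl"
  have pw: "X ^ i \<le> Y" if "i \<le> 4" for i
  proof -
    have "X ^ 4 * 1 \<le> Y" unfolding Y_def using assms(8) X1 by (intro mult_left_mono) auto
    then show ?thesis using power_increasing[OF that X1] by linarith
  qed
  have "real n * (real n * real tc) \<le> X * (X * (568 * X ^ 2 * Dl))"
    using assms(1,2) tc X1 by (intro mult_mono) auto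
  then have t1: "real n * (real n * real tc) \<le> 568 * Y"
    by (simp add: Y_def power2_eq_square power4_eq_xxxx mult_ac)
  have "real n * ov \<le> X * (284 * X ^ 2)" using assms(1,2) ov ov0 X1 by (intro mult_mono) auto
  then have t2: "real n * ov \<le> 284 * Y" using pw[of 3] by (simp add: power2_eq_square power3_eq_cube)
  have t3: "real n * real n \<le> Y"
    using mult_mono[OF assms(2,2)] pw[of 2] assms(1) X1 by (simp add: power2_eq_square)
  have t4: "real n \<le> Y" "real m \<le> Y" "1 \<le> Y" using pw[of 1] pw[of 0] assms by simp_all
  \<comment> \<open>\<open>Y\<close> dominates every summand except the oracle cost, and 1324 = 36 +
    24 + 568 + 284 + 12 + 100 + 300. The constant 1600 of the conclusion rounds up 1324 + 48 + 12 +
    200.\<close>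
  have R_le: "R \<le> 3 * C * X ^ e + 1324 * Y"
    unfolding R distrib_left using t1 t2 t3 t4 assms(6) by linarith
  have "real m * R \<le> X * (3 * C * X ^ e + 1324 * Y)"
  proof (rule order_trans[OF mult_left_mono[OF R_le]])
    show "real m * (3 * C * X ^ e + 1324 * Y) \<le> X * (3 * C * X ^ e + 1324 * Y)"
      using assms(4,7) X1 t4 by (intro mult_right_mono add_nonneg_nonneg mult_nonneg_nonneg) auto
  qed simp
  moreover have "X * 1 \<le> X * Y" using t4 X1 by (intro mult_left_mono) auto
  moreover have "X * Y = X ^ 5 * Dl" by (simp add: Y_def eval_nat_numeral)
  moreover have "X ^ 5 * Dl \<le> X ^ (6 + e) * Dl"
    using X1 assms(8) by (intro mult_right_mono power_increasing) auto
  moreover have "C * (X ^ (1 + e) * 1) \<le> C * (X ^ (6 + e) * Dl)"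
    using X1 assms(7,8) by (intro mult_left_mono mult_mono power_increasing) auto
  ultimately show ?thesis using assms(4,5) X1 unfolding distrib_left distrib_right by (simp add: mult_ac)
qed

theorem theorem4p1:
  fixes b :: "nat poly"
  shows "\<exists>K :: real. \<forall>Q :: program. \<exists>P :: program.
    \<forall>(x :: val) (m :: nat) (n :: nat) (A :: nat \<Rightarrow> nat set) (E :: nat \<Rightarrow> (nat \<Rightarrow> bool) set)
      (z :: nat \<Rightarrow> real) (\<alpha> :: real) (d :: nat).
      1 \<le> m \<longrightarrow> 1 \<le> n \<longrightarrow> event_system m n A E \<longrightarrow>
      d = max_degree {..<n} (dep_adj A) \<longrightarrow>
      unit_vector m z \<longrightarrow> 0 < \<alpha> \<longrightarrow> \<alpha> \<le> 1 \<longrightarrow>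
      (\<lambda>i. (1 + \<alpha>) * event_prob m E z i) \<in> shearer_region {..<n} (dep_adj A) \<longrightarrow>
      computes_probs Q b x m n E \<longrightarrow>
      (\<exists>t \<omega>. runs P (instance_input x m n A z \<alpha>) t (vpoint m \<omega>) \<and>
             \<omega> \<in> cube m \<and> \<omega> \<in> (\<Inter>i<n. cube m - E i) \<and>
             real t \<le> K * (real n * real m / \<alpha>) powr
                         (K * ln (real (max 2 d)) * sqrt (real m / \<alpha>)))"
proof -
  define e where "e = degree b"
  define C where "C = real (\<Sum>i\<le>degree b. coeff b i)"
  \<comment> \<open>The sum dominates both the leading factor and the constant in the exponent: 45
    comes from \<open>exponent_bound\<close>, and \<open>2 * (6 + real e)\<close> absorbs the
    polynomial factor \<open>X ^ (6 + e)\<close>. Only \<open>b\<close> enters.\<close>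
  define K where "K = (3 * C + 1600) * 2 ^ 36 + (45 + 2 * (6 + real e))"
  have C0: "0 \<le> C" unfolding C_def by (rule of_nat_0_le_iff)
  then have K0: "0 \<le> K" by (simp add: K_def)
  have "\<exists>t \<omega>. runs (rounding_algorithm Q) (instance_input x m n A z \<alpha>) t (vpoint m \<omega>) \<and>
      \<omega> \<in> cube m \<and> \<omega> \<in> (\<Inter>i<n. cube m - E i) \<and>
      real t \<le> K * (real n * real m / \<alpha>) powr (K * ln (real (max 2 d)) * sqrt (real m / \<alpha>))"
    if m: "1 \<le> m" and n: "1 \<le> n" and system: "event_system m n A E"
      and d: "d = max_degree {..<n} (dep_adj A)" and z: "unit_vector m z"
      and \<alpha>: "0 < \<alpha>" "\<alpha> \<le> 1"
      and reg: "(\<lambda>i. (1 + \<alpha>) * event_prob m E z i) \<in> shearer_region {..<n} (dep_adj A)"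
      and Q: "computes_probs Q b x m n E"
    for Q x m n A E z \<alpha> d
  proof -
    define D where "D = max 2 d"
    define \<delta> where "\<delta> = \<alpha> / (2 * real m)"
    define w where "w = 16 * (real n)\<^sup>2 / \<delta> ^ 4"
    define X where "X = real n * real m / \<alpha>"
    define s where "s = sqrt (real m / \<alpha>)"
    obtain k where k: "1 \<le> k" "\<And>i. i < k \<Longrightarrow> 1 \<le> i \<Longrightarrow> real i * real i * \<alpha> < real m"
      "\<not> real k * real k * \<alpha> < real m" "real k \<le> 2 * s"
      using least_square_root_scale[OF \<alpha> m] unfolding s_def by blast
    define h where "h = 1 / real k"
    obtain L where L: "w < 2 ^ L" "real L \<le> 9 * (1 + ln X)"
      using depth_bound[OF m n \<alpha> w_def[unfolded \<delta>_def]] unfolding X_def by blast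
    have \<delta>01: "0 < \<delta>" "\<delta> \<le> 1" using \<alpha> m by (auto simp: \<delta>_def field_simps)
    have h01: "0 \<le> h" "h \<le> 1" using k(1) by (auto simp: h_def)
    \<comment> \<open>The stopping condition of the search, k^2 * \<alpha> \<ge> m, read as 1/k^2
      \<le> \<alpha>/m = 2\<delta>.\<close>
    have h2: "h\<^sup>2 \<le> 2 * \<delta>"
      using k(1,3) m \<alpha> by (simp add: h_def \<delta>_def field_simps power2_eq_square)
    have l: "w < (1 + h) ^ (k * L)"
      using L(1) power_one_plus_inverse_ge[OF k(1), of L] unfolding h_def by linarith
    have deg: "card {j. j < n \<and> dep_adj A i j} \<le> D" if "i < n" for i
    proof -
      have "card {u \<in> {..<n}. dep_adj A i u} \<le> max_degree {..<n} (dep_adj A)"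
        unfolding max_degree_def using that by (intro Max_ge) auto
      then show ?thesis by (simp add: D_def d)
    qed
    let ?c = "length (fst Q)" and ?Fs = "fst (rounding_algorithm Q)"
    have probs: "call_within ?Fs ?c (VCons x (VCons (vvec m y) VNil)) (poly b m) (vvec n (event_prob m E y))"
      if y: "unit_vector m y" for y
      using Q y call_within_oracle unfolding computes_probs_def by fastforce
    interpret rounding_program ?Fs ?c by (rule rounding_program_algorithm)
    interpret rounding_run ?Fs ?c m n D A E x "poly b m" \<delta> h w "k * L"
      by unfold_locales
        (use system probs \<delta>01 h01 h2 l deg in \<open>auto simp: event_system_def D_def w_def\<close>)
    have reg': "(\<lambda>i. (1 + \<alpha>) * event_prob m E z i) \<in> positive_region (dep_adj A) {..<n}"
      using shearer_region_imp_positive[OF _ reg, of 1] by simp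
    obtain \<omega> t where \<omega>: "\<omega> \<in> cube m" "\<omega> \<in> (\<Inter>i<n. cube m - E i)"
      and t: "eval ?Fs [instance_input x m n A z \<alpha>] (main_body ?c) t (vpoint m \<omega>)"
        "t \<le> 24 * k + m * round_cost + 12 * m + 200"
      using main_within[OF \<alpha> m \<delta>_def k(1-3) h_def z reg'] unfolding eval_within_def by blast
    have nm: "1 \<le> real n" "1 \<le> real m" using m n by auto
    have nX: "real n \<le> X" "real m \<le> X" "real m / \<alpha> \<le> X"
    proof -
      have "real n * \<alpha> \<le> real n * real m" "real m * \<alpha> \<le> real m * real n"
        using \<alpha> nm by (intro mult_left_mono; simp)+
      then show "real n \<le> X" "real m \<le> X"
        unfolding X_def pos_le_divide_eq[OF \<alpha>(1)] by (simp_all add: mult.commute)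
      show "real m / \<alpha> \<le> X"
        unfolding X_def using \<alpha> nm mult_right_mono[of 1 "real n" "real m"] by (intro divide_right_mono) auto
    qed
    have X1: "1 \<le> X" using nX nm by linarith
    have s1: "1 \<le> s" using m \<alpha> by (simp add: s_def field_simps)
    have "s * s = real m / \<alpha>" using m \<alpha> by (simp add: s_def)
    then have sX: "s \<le> X" using s1 mult_left_mono[of 1 s s] nX(3) by linarith
    define Dl where "Dl = real D ^ (k * L)"
    have Dl: "1 \<le> Dl" unfolding Dl_def by (rule one_le_power) (simp add: D_def)
    have B: "real (poly b m) \<le> C * X ^ e"
    proof -
      have "real (poly b m) \<le> real ((\<Sum>i\<le>degree b. coeff b i) * m ^ degree b)"
        using poly_nat_le_monomial[OF m, of b] by (rule of_nat_mono)
      also have "\<dots> = C * real m ^ e" by (simp add: C_def e_def)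
      also have "\<dots> \<le> C * X ^ e" using C0 nX(2) by (intro mult_left_mono power_mono) auto
      finally show ?thesis .
    qed
    have tc: "real (tree_cost overhead D (k * L)) \<le> 2 * real overhead * Dl"
    proof -
      have "tree_cost overhead D (k * L) \<le> overhead * (2 * D ^ (k * L))"
        unfolding tree_cost_def by (intro mult_le_mono2) simp
      then have "real (tree_cost overhead D (k * L)) \<le> real (overhead * (2 * D ^ (k * L)))" by (rule of_nat_mono)
      then show ?thesis by (simp add: Dl_def mult_ac)
    qed
    have "real t \<le> real (24 * k + m * round_cost + 12 * m + 200)" using t(2) by (rule of_nat_mono)
    also have "\<dots> = 24 * real k + real m * real round_cost + 12 * real m + 200" by simp
    also have "\<dots> \<le> (3 * C + 1600) * X ^ (6 + e) * Dl"
    proof (rule total_cost_bound[OF nm(1) nX(1) nm(2) nX(2) _ B C0 Dl tc])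
      show "real k \<le> 2 * X" using k(4) sX by linarith
      show "real overhead = (real n + 1) * (32 * real m + 60) + 100" by (simp add: overhead_def distrib_right)
    qed (simp add: round_cost_def)
    also have "\<dots> \<le> (3 * C + 1600) * X ^ (6 + e) * (2 ^ 36 * X powr (45 * ln (real D) * s))"
    proof (rule mult_left_mono)
      have "real k * real L \<le> 2 * s * (9 * (1 + ln X))"
        using k(4) L(2) s1 by (intro mult_mono) auto
      then have "real (k * L) \<le> 18 * s * (1 + ln X)" by (simp add: algebra_simps)
      then show "Dl \<le> 2 ^ 36 * X powr (45 * ln (real D) * s)"
        unfolding Dl_def D_def s_def X_def by (rule exponent_bound[OF m n \<alpha> d])
    qed (use C0 X1 in auto)
    also have "\<dots> = (3 * C + 1600) * 2 ^ 36 * (X powr (6 + real e) * X powr (45 * ln (real D) * s))"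
      using X1 powr_realpow[of X "6 + e"] by simp
    also have "\<dots> \<le> (3 * C + 1600) * 2 ^ 36 *
        (X powr (2 * (6 + real e) * ln (real D) * s) * X powr (45 * ln (real D) * s))"
    proof (intro mult_left_mono mult_right_mono powr_mono[OF _ X1])
      \<comment> \<open>The maximum with 2 in \<open>D\<close> keeps \<open>ln D * s\<close> above
        2/3, so a power of \<open>X\<close> with this exponent can absorb a polynomial in
        \<open>X\<close>.\<close>
      have "ln 2 \<le> ln (real D)" by (simp add: D_def)
      then have "2 / 3 * 1 \<le> ln (real D) * s" using ln2_ge_two_thirds s1 by (intro mult_mono) auto
      then have "(6 + real e) * 1 \<le> (6 + real e) * (2 * (ln (real D) * s))" by (intro mult_left_mono) auto
      then show "6 + real e \<le> 2 * (6 + real e) * ln (real D) * s" by (simp add: algebra_simps)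
    qed (use C0 in auto)
    also have "\<dots> = (3 * C + 1600) * 2 ^ 36 * X powr ((45 + 2 * (6 + real e)) * ln (real D) * s)"
      by (simp add: powr_add[symmetric] algebra_simps)
    also have "\<dots> \<le> K * X powr (K * ln (real D) * s)"
    proof (intro mult_mono powr_mono X1 mult_right_mono)
      show "(3 * C + 1600) * 2 ^ 36 \<le> K" using C0 by (simp add: K_def)
      show "45 + 2 * (6 + real e) \<le> K" using C0 by (simp add: K_def)
    qed (use s1 K0 in \<open>auto simp: D_def\<close>)
    finally have "real t \<le> K * X powr (K * ln (real D) * s)" .
    then show ?thesis
      using \<omega> t(1) unfolding X_def s_def D_def
      by (intro exI[of _ t] exI[of _ \<omega>]) (simp add: runs_def rounding_algorithm_def Let_def)
  qed
  then show ?thesis by blast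
qed

end
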